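(* Let $\lambda_0,\lambda_1,\lambda_2,\mu,\alpha_1,\alpha_2>0$, $\lambda=\lambda_0+\lambda_1+\lambda_2$, with $\lambda+\mu+\alpha_1+\alpha_2=1$. Put $\widehat{\lambda}=\lambda(\lambda+\alpha_1+\alpha_2)$, $\widehat{\lambda}_k=\lambda_k(\lambda+\alpha_1+\alpha_2)$ and $\widehat{\mu}_k=\mu\alpha_k$ for $k=1,2$, $\rho_k=\widehat{\lambda}_k/\widehat{\mu}_k$ for $k=1,2$, $\rho=\widehat{\lambda}/(\widehat{\mu}_1+\widehat{\mu}_2)$, and $f_k=\dfrac{\lambda(\lambda_k+\alpha_k)}{\widehat{\mu}_k}-1$ for $k=1,2$. Let $\{\tilde{X}(n);n\ge 0\}$ be the censored chain at busy states of the generalized join the shortest orbit queue system, i.e. the discrete-time Markov chain on $\mathbb{N}_0\times\mathbb{N}_0$ with the transition probabilities given in the context. Then $\{\tilde{X}(n);n\ge 0\}$ is positive recurrent if and only if one of the following conditions holds: (1) $\rho_1<1$, $\rho_2<1$ and $\rho<1$; (2) $\rho_1\ge 1$ and $f_1<0$; (3) $\rho_2\ge 1$ and $f_2<0$.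
   Context: The chain $\tilde{X}$ records the two orbit queue lengths $(i,j)$ of a single-server retrial system observed at epochs when the server is busy. Here $\lambda_0$ is the rate of the smart stream (blocked jobs join the shorter orbit, ties broken with probability $1/2$), $\lambda_1,\lambda_2$ are the rates of the streams dedicated to orbits 1 and 2, $\mu$ is the service rate, and $\alpha_1,\alpha_2$ are the constant retrial rates. Its one-step transition probabilities $p_{a,b}$ from $(i,j)$ to $(i+a,j+b)$ are as follows (all others are $0$), with $D=\lambda+\alpha_1+\alpha_2$: - $i>j>0$: $p_{1,0}=\lambda_1$, $p_{0,1}=\lambda_0+\lambda_2$, $p_{-1,0}=\widehat{\mu}_1/D$, $p_{0,-1}=\widehat{\mu}_2/D$, $p_{0,0}=\alpha_1+\alpha_2+\lambda\mu/D$. - $j>i>0$: $p_{1,0}=\lambda_0+\lambda_1$, $p_{0,1}=\lambda_2$, $p_{-1,0}=\widehat{\mu}_1/D$, $p_{0,-1}=\widehat{\mu}_2/D$, $p_{0,0}=\alpha_1+\alpha_2+\lambda\mu/D$. - $i=j>0$: $p_{1,0}=\lambda_0/2+\lambda_1$, $p_{0,1}=\lambda_0/2+\lambda_2$, $p_{-1,0}=\widehat{\mu}_1/D$, $p_{0,-1}=\widehat{\mu}_2/D$, $p_{0,0}=\alpha_1+\alpha_2+\lambda\mu/D$. - $i=0$, $j>0$: $p_{1,0}=\lambda_0+\lambda_1$, $p_{0,1}=\lambda_2$, $p_{0,-1}=\widehat{\mu}_2/(\lambda+\alpha_2)$, $p_{0,0}=\alpha_1+\alpha_2+\lambda\mu/(\lambda+\alpha_2)$.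 - $j=0$, $i>0$: $p_{1,0}=\lambda_1$, $p_{0,1}=\lambda_0+\lambda_2$, $p_{-1,0}=\widehat{\mu}_1/(\lambda+\alpha_1)$, $p_{0,0}=\alpha_1+\alpha_2+\lambda\mu/(\lambda+\alpha_1)$. - $i=j=0$: $p_{1,0}=\lambda_0/2+\lambda_1$, $p_{0,1}=\lambda_0/2+\lambda_2$, $p_{0,0}=\alpha_1+\alpha_2+\mu$. *)

theory Defs
  imports "HOL-Probability.Probability"
begin

text \<open>
  A process with values in a discrete state space is a Markov chain with transition matrix \<open>p\<close>
  started in \<open>x\<close>. Only histories of positive probability are conditioned on.
\<close>

definition markov_chain_from ::
    "'w measure \<Rightarrow> ('a \<Rightarrow> 'a \<Rightarrow> real) \<Rightarrow> 'a \<Rightarrow> (nat \<Rightarrow> 'w \<Rightarrow> 'a) \<Rightarrow> bool" where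
  "markov_chain_from M p x X \<longleftrightarrow>
     prob_space M \<and>
     (\<forall>n. X n \<in> M \<rightarrow>\<^sub>M count_space UNIV) \<and>
     (AE \<omega> in M. X 0 \<omega> = x) \<and>
     (\<forall>n s y. \<P>(\<omega> in M. \<forall>k\<le>n. X k \<omega> = s k) > 0 \<longrightarrow>
        \<P>(\<omega> in M. X (Suc n) \<omega> = y \<bar> \<forall>k\<le>n. X k \<omega> = s k) = p (s n) y)"

text \<open>The infimum of the empty set is \<open>\<infinity>\<close>, the value of the return time if there is no return.\<close>

definition return_time :: "(nat \<Rightarrow> 'w \<Rightarrow> 'a) \<Rightarrow> 'a \<Rightarrow> 'w \<Rightarrow> ennreal" where
  "return_time X s \<omega> = (INF n \<in> {n. 1 \<le> n \<and> X n \<omega> = s}. of_nat n)"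

text \<open>
  A chain is given by a process \<open>X\<close> and the family \<open>P\<close> of its laws, where \<open>P s\<close> is the law
  under which \<open>X\<close> starts in \<open>s\<close>.
\<close>

definition positive_recurrent :: "('a \<Rightarrow> 'w measure) \<Rightarrow> (nat \<Rightarrow> 'w \<Rightarrow> 'a) \<Rightarrow> bool" where
  "positive_recurrent P X \<longleftrightarrow> (\<forall>s. (\<integral>\<^sup>+ \<omega>. return_time X s \<omega> \<partial>P s) < \<infinity>)"

definition nn_jump :: "real \<Rightarrow> real \<Rightarrow> real \<Rightarrow> real \<Rightarrow> real \<Rightarrow> int \<times> int \<Rightarrow> real" where
  "nn_jump east north west south stay d =
     (if d = (1, 0) then east
      else if d = (0, 1) then north
      else if d = (-1, 0) then west
      else if d = (0, -1) then south
      else if d = (0, 0) then stay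
      else 0)"

definition jsq_jump ::
    "real \<Rightarrow> real \<Rightarrow> real \<Rightarrow> real \<Rightarrow> real \<Rightarrow> real \<Rightarrow> nat \<times> nat \<Rightarrow> int \<times> int \<Rightarrow> real" where
  "jsq_jump lam\<^sub>0 lam\<^sub>1 lam\<^sub>2 \<mu> \<alpha>\<^sub>1 \<alpha>\<^sub>2 = (\<lambda>(i, j).
     let lam = lam\<^sub>0 + lam\<^sub>1 + lam\<^sub>2; D = lam + \<alpha>\<^sub>1 + \<alpha>\<^sub>2 in
     if i > j \<and> j > 0 then
       nn_jump lam\<^sub>1 (lam\<^sub>0 + lam\<^sub>2) (\<mu> * \<alpha>\<^sub>1 / D) (\<mu> * \<alpha>\<^sub>2 / D) (\<alpha>\<^sub>1 + \<alpha>\<^sub>2 + lam * \<mu> / D)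
     else if j > i \<and> i > 0 then
       nn_jump (lam\<^sub>0 + lam\<^sub>1) lam\<^sub>2 (\<mu> * \<alpha>\<^sub>1 / D) (\<mu> * \<alpha>\<^sub>2 / D) (\<alpha>\<^sub>1 + \<alpha>\<^sub>2 + lam * \<mu> / D)
     else if i = j \<and> j > 0 then
       nn_jump (lam\<^sub>0 / 2 + lam\<^sub>1) (lam\<^sub>0 / 2 + lam\<^sub>2) (\<mu> * \<alpha>\<^sub>1 / D) (\<mu> * \<alpha>\<^sub>2 / D)
         (\<alpha>\<^sub>1 + \<alpha>\<^sub>2 + lam * \<mu> / D)
     else if i = 0 \<and> j > 0 then
       nn_jump (lam\<^sub>0 + lam\<^sub>1) lam\<^sub>2 0 (\<mu> * \<alpha>\<^sub>2 / (lam + \<alpha>\<^sub>2)) (\<alpha>\<^sub>1 + \<alpha>\<^sub>2 + lam * \<mu> / (lam + \<alpha>\<^sub>2))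
     else if j = 0 \<and> i > 0 then
       nn_jump lam\<^sub>1 (lam\<^sub>0 + lam\<^sub>2) (\<mu> * \<alpha>\<^sub>1 / (lam + \<alpha>\<^sub>1)) 0 (\<alpha>\<^sub>1 + \<alpha>\<^sub>2 + lam * \<mu> / (lam + \<alpha>\<^sub>1))
     else
       nn_jump (lam\<^sub>0 / 2 + lam\<^sub>1) (lam\<^sub>0 / 2 + lam\<^sub>2) 0 0 (\<alpha>\<^sub>1 + \<alpha>\<^sub>2 + \<mu>))"

definition jsq_trans ::
    "real \<Rightarrow> real \<Rightarrow> real \<Rightarrow> real \<Rightarrow> real \<Rightarrow> real \<Rightarrow> nat \<times> nat \<Rightarrow> nat \<times> nat \<Rightarrow> real" where
  "jsq_trans lam\<^sub>0 lam\<^sub>1 lam\<^sub>2 \<mu> \<alpha>\<^sub>1 \<alpha>\<^sub>2 = (\<lambda>(i, j) (k, l).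
     jsq_jump lam\<^sub>0 lam\<^sub>1 lam\<^sub>2 \<mu> \<alpha>\<^sub>1 \<alpha>\<^sub>2 (i, j) (int k - int i, int l - int j))"

text \<open>
  The matrix is stochastic, and every stochastic matrix on a countable state space is the
  transition matrix of such a family of chains, so statements about all of them are not vacuous.
\<close>

lemma jsq_trans_stochastic:
  fixes lam\<^sub>0 lam\<^sub>1 lam\<^sub>2 \<mu> \<alpha>\<^sub>1 \<alpha>\<^sub>2 :: real
  assumes pos: "lam\<^sub>0 > 0" "lam\<^sub>1 > 0" "lam\<^sub>2 > 0" "\<mu> > 0" "\<alpha>\<^sub>1 > 0" "\<alpha>\<^sub>2 > 0"
    and one: "lam\<^sub>0 + lam\<^sub>1 + lam\<^sub>2 + \<mu> + \<alpha>\<^sub>1 + \<alpha>\<^sub>2 = 1"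
  shows "jsq_trans lam\<^sub>0 lam\<^sub>1 lam\<^sub>2 \<mu> \<alpha>\<^sub>1 \<alpha>\<^sub>2 x y \<ge> 0"
    and "(\<integral>\<^sup>+ y. ennreal (jsq_trans lam\<^sub>0 lam\<^sub>1 lam\<^sub>2 \<mu> \<alpha>\<^sub>1 \<alpha>\<^sub>2 x y) \<partial>count_space UNIV) = 1"
proof -
  let ?p = "jsq_trans lam\<^sub>0 lam\<^sub>1 lam\<^sub>2 \<mu> \<alpha>\<^sub>1 \<alpha>\<^sub>2"
  let ?J = "jsq_jump lam\<^sub>0 lam\<^sub>1 lam\<^sub>2 \<mu> \<alpha>\<^sub>1 \<alpha>\<^sub>2"
  define L where "L = lam\<^sub>0 + lam\<^sub>1 + lam\<^sub>2"
  define D where "D = L + \<alpha>\<^sub>1 + \<alpha>\<^sub>2"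
  have L: "L > 0" "D > 0" "L + \<alpha>\<^sub>1 > 0" "L + \<alpha>\<^sub>2 > 0"
    using pos by (simp_all add: L_def D_def)
  have one': "L + \<mu> + \<alpha>\<^sub>1 + \<alpha>\<^sub>2 = 1"
    using one by (simp add: L_def)
  have inner: "\<mu> * \<alpha>\<^sub>1 / D + \<mu> * \<alpha>\<^sub>2 / D + L * \<mu> / D = \<mu>"
  proof -
    have "\<mu> * \<alpha>\<^sub>1 / D + \<mu> * \<alpha>\<^sub>2 / D + L * \<mu> / D = \<mu> * D / D"
      unfolding add_divide_distrib[symmetric] by (simp add: D_def algebra_simps)
    then show ?thesis using L by simp
  qed
  have axis: "\<mu> * a / (L + a) + L * \<mu> / (L + a) = \<mu>" if "L + a > 0" for a
  proof -
    have "\<mu> * a / (L + a) + L * \<mu> / (L + a) = \<mu> * (L + a) / (L + a)"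
      unfolding add_divide_distrib[symmetric] by (simp add: algebra_simps)
    then show ?thesis using that by simp
  qed
  note axes = axis[OF L(3)] axis[OF L(4)]
  have form: "\<exists>e n w s t. 0 \<le> e \<and> 0 \<le> n \<and> 0 \<le> w \<and> 0 \<le> s \<and> 0 \<le> t \<and> e + n + w + s + t = 1 \<and>
      (i = 0 \<longrightarrow> w = 0) \<and> (j = 0 \<longrightarrow> s = 0) \<and> ?J (i, j) = nn_jump e n w s t"
    (is "\<exists>e n w s t. ?F e n w s t") for i j
  proof -
    have nn: "0 \<le> lam\<^sub>0" "0 \<le> lam\<^sub>1" "0 \<le> lam\<^sub>2" "0 \<le> \<mu>" "0 \<le> \<alpha>\<^sub>1" "0 \<le> \<alpha>\<^sub>2"
      "0 \<le> \<mu> * \<alpha>\<^sub>1 / D" "0 \<le> \<mu> * \<alpha>\<^sub>2 / D" "0 \<le> L * \<mu> / D"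
      "0 \<le> \<mu> * \<alpha>\<^sub>1 / (L + \<alpha>\<^sub>1)" "0 \<le> L * \<mu> / (L + \<alpha>\<^sub>1)"
      "0 \<le> \<mu> * \<alpha>\<^sub>2 / (L + \<alpha>\<^sub>2)" "0 \<le> L * \<mu> / (L + \<alpha>\<^sub>2)"
      using pos L by simp_all
    have J: "?J (i, j) =
        (if i > j \<and> j > 0 then
           nn_jump lam\<^sub>1 (lam\<^sub>0 + lam\<^sub>2) (\<mu> * \<alpha>\<^sub>1 / D) (\<mu> * \<alpha>\<^sub>2 / D) (\<alpha>\<^sub>1 + \<alpha>\<^sub>2 + L * \<mu> / D)
         else if j > i \<and> i > 0 then
           nn_jump (lam\<^sub>0 + lam\<^sub>1) lam\<^sub>2 (\<mu> * \<alpha>\<^sub>1 / D) (\<mu> * \<alpha>\<^sub>2 / D) (\<alpha>\<^sub>1 + \<alpha>\<^sub>2 + L * \<mu> / D)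
         else if i = j \<and> j > 0 then
           nn_jump (lam\<^sub>0 / 2 + lam\<^sub>1) (lam\<^sub>0 / 2 + lam\<^sub>2) (\<mu> * \<alpha>\<^sub>1 / D) (\<mu> * \<alpha>\<^sub>2 / D)
             (\<alpha>\<^sub>1 + \<alpha>\<^sub>2 + L * \<mu> / D)
         else if i = 0 \<and> j > 0 then
           nn_jump (lam\<^sub>0 + lam\<^sub>1) lam\<^sub>2 0 (\<mu> * \<alpha>\<^sub>2 / (L + \<alpha>\<^sub>2)) (\<alpha>\<^sub>1 + \<alpha>\<^sub>2 + L * \<mu> / (L + \<alpha>\<^sub>2))
         else if j = 0 \<and> i > 0 then
           nn_jump lam\<^sub>1 (lam\<^sub>0 + lam\<^sub>2) (\<mu> * \<alpha>\<^sub>1 / (L + \<alpha>\<^sub>1)) 0 (\<alpha>\<^sub>1 + \<alpha>\<^sub>2 + L * \<mu> / (L + \<alpha>\<^sub>1))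
         else
           nn_jump (lam\<^sub>0 / 2 + lam\<^sub>1) (lam\<^sub>0 / 2 + lam\<^sub>2) 0 0 (\<alpha>\<^sub>1 + \<alpha>\<^sub>2 + \<mu>))"
      unfolding jsq_jump_def Let_def L_def D_def prod.case ..
    consider "i > j" "j > 0" | "j > i" "i > 0" | "i = j" "j > 0" | "i = 0" "j > 0"
      | "j = 0" "i > 0" | "i = 0" "j = 0"
      by linarith
    then show ?thesis
    proof cases
      case 1
      then have "?F lam\<^sub>1 (lam\<^sub>0 + lam\<^sub>2) (\<mu> * \<alpha>\<^sub>1 / D) (\<mu> * \<alpha>\<^sub>2 / D) (\<alpha>\<^sub>1 + \<alpha>\<^sub>2 + L * \<mu> / D)"
        unfolding J using nn inner one' L_def by (intro conjI) (linarith | simp)+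
      then show ?thesis by blast
    next
      case 2
      then have "?F (lam\<^sub>0 + lam\<^sub>1) lam\<^sub>2 (\<mu> * \<alpha>\<^sub>1 / D) (\<mu> * \<alpha>\<^sub>2 / D) (\<alpha>\<^sub>1 + \<alpha>\<^sub>2 + L * \<mu> / D)"
        unfolding J using nn inner one' L_def by (intro conjI) (linarith | simp)+
      then show ?thesis by blast
    next
      case 3
      then have "?F (lam\<^sub>0 / 2 + lam\<^sub>1) (lam\<^sub>0 / 2 + lam\<^sub>2) (\<mu> * \<alpha>\<^sub>1 / D) (\<mu> * \<alpha>\<^sub>2 / D)
          (\<alpha>\<^sub>1 + \<alpha>\<^sub>2 + L * \<mu> / D)"
        unfolding J using nn inner one' L_def by (intro conjI) (linarith | simp)+
      then show ?thesis by blast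
    next
      case 4
      then have "?F (lam\<^sub>0 + lam\<^sub>1) lam\<^sub>2 0 (\<mu> * \<alpha>\<^sub>2 / (L + \<alpha>\<^sub>2)) (\<alpha>\<^sub>1 + \<alpha>\<^sub>2 + L * \<mu> / (L + \<alpha>\<^sub>2))"
        unfolding J using nn axes one' L_def by (intro conjI) (linarith | simp)+
      then show ?thesis by blast
    next
      case 5
      then have "?F lam\<^sub>1 (lam\<^sub>0 + lam\<^sub>2) (\<mu> * \<alpha>\<^sub>1 / (L + \<alpha>\<^sub>1)) 0 (\<alpha>\<^sub>1 + \<alpha>\<^sub>2 + L * \<mu> / (L + \<alpha>\<^sub>1))"
        unfolding J using nn axes one' L_def by (intro conjI) (linarith | simp)+
      then show ?thesis by blast
    next
      case 6
      then have "?F (lam\<^sub>0 / 2 + lam\<^sub>1) (lam\<^sub>0 / 2 + lam\<^sub>2) 0 0 (\<alpha>\<^sub>1 + \<alpha>\<^sub>2 + \<mu>)"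
        unfolding J using nn one' L_def by (intro conjI) (linarith | simp)+
      then show ?thesis by blast
    qed
  qed
  obtain i j where x: "x = (i, j)" by (cases x)
  from form[of i j] obtain e n w s t where
    est: "0 \<le> e" "0 \<le> n" "0 \<le> w" "0 \<le> s" "0 \<le> t" "e + n + w + s + t = 1"
      "i = 0 \<longrightarrow> w = 0" "j = 0 \<longrightarrow> s = 0" and J: "?J (i, j) = nn_jump e n w s t"
    by blast
  have p: "?p x (k, l) = nn_jump e n w s t (int k - int i, int l - int j)" for k l
    by (simp add: x jsq_trans_def J)
  have nonneg: "?p x y \<ge> 0" for y
    using est by (cases y) (simp add: p nn_jump_def)
  then show "?p x y \<ge> 0" .
  have v: "?p x (i, j) = t" "?p x (Suc i, j) = e" "?p x (i, Suc j) = n"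
    "\<And>m. i = Suc m \<Longrightarrow> ?p x (m, j) = w" "\<And>m. j = Suc m \<Longrightarrow> ?p x (i, m) = s"
    by (simp_all add: p nn_jump_def)
  define A where "A = {(i, j), (Suc i, j), (i, Suc j)} \<union> (\<lambda>m. (m, j)) ` {m. i = Suc m}
    \<union> (\<lambda>m. (i, m)) ` {m. j = Suc m}"
  have Suc_set: "{m. Suc k = Suc m} = {k}" for k
    by auto
  have fin: "finite A"
    unfolding A_def by (cases i; cases j) (simp_all add: Suc_set)
  have zero: "?p x y = 0" if "y \<notin> A" for y
  proof (rule ccontr)
    assume nz: "?p x y \<noteq> 0"
    obtain k l where y: "y = (k, l)" by (cases y)
    have supp: "d \<in> {(1, 0), (0, 1), (-1, 0), (0, -1), (0, 0)}" if "nn_jump e n w s t d \<noteq> 0" for d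
    proof (rule ccontr)
      assume "d \<notin> {(1, 0), (0, 1), (-1, 0), (0, -1), (0, 0)}"
      then have "nn_jump e n w s t d = 0"
        unfolding nn_jump_def insert_iff de_Morgan_disj by (simp only: if_False)
      with that show False by contradiction
    qed
    have "(int k - int i, int l - int j) \<in> {(1, 0), (0, 1), (-1, 0), (0, -1), (0, 0)}"
      by (rule supp) (use nz in \<open>simp only: y p not_False_eq_True\<close>)
    then have "k = Suc i \<and> l = j \<or> k = i \<and> l = Suc j \<or> i = Suc k \<and> l = j \<or> k = i \<and> j = Suc l \<or> k = i \<and> l = j"
      unfolding insert_iff empty_iff prod.inject by (elim disjE) auto
    then show False using that unfolding y A_def by blast
  qed
  have "(\<Sum>y\<in>A. ?p x y) = e + n + w + s + t"
  proof (cases i; cases j)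
    assume ij: "i = 0" "j = 0"
    then have "A = {(i, j), (Suc i, j), (i, Suc j)}" by (simp add: A_def)
    then show ?thesis using est ij v(1-3) by simp
  next
    fix l assume ij: "i = 0" "j = Suc l"
    then have "A = {(i, j), (Suc i, j), (i, Suc j), (i, l)}" by (auto simp add: A_def)
    then show ?thesis using est ij v(1-3) v(5)[OF ij(2)] by simp
  next
    fix k assume ij: "i = Suc k" "j = 0"
    then have "A = {(i, j), (Suc i, j), (i, Suc j), (k, j)}" by (auto simp add: A_def)
    then show ?thesis using est ij v(1-3) v(4)[OF ij(1)] by simp
  next
    fix k l assume ij: "i = Suc k" "j = Suc l"
    then have "A = {(i, j), (Suc i, j), (i, Suc j), (k, j), (i, l)}" by (auto simp add: A_def)
    then show ?thesis using est ij v(1-3) v(4)[OF ij(1)] v(5)[OF ij(2)] by simp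
  qed
  then have sum: "(\<Sum>y\<in>A. ?p x y) = 1"
    using est by simp
  have "(\<integral>\<^sup>+ y. ennreal (?p x y) \<partial>count_space UNIV) = (\<Sum>y\<in>A. ennreal (?p x y))"
    by (rule nn_integral_count_space') (auto simp: zero fin)
  also have "\<dots> = 1"
    using sum nonneg by (simp add: sum_ennreal)
  finally show "(\<integral>\<^sup>+ y. ennreal (?p x y) \<partial>count_space UNIV) = 1" .
qed

lemma markov_chain_family_exists:
  fixes p :: "'a::countable \<Rightarrow> 'a \<Rightarrow> real"
  assumes nonneg: "\<And>x y. p x y \<ge> 0"
    and sum1: "\<And>x. (\<integral>\<^sup>+ y. ennreal (p x y) \<partial>count_space UNIV) = 1"
  shows "\<exists>(P :: 'a \<Rightarrow> (nat \<times> 'a \<Rightarrow> 'a) measure) X. \<forall>x. markov_chain_from (P x) p x X"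
proof -
  define K where "K x = embed_pmf (p x)" for x
  have K: "pmf (K x) y = p x y" for x y
    unfolding K_def by (rule pmf_embed_pmf) (use nonneg sum1 in auto)
  define Q where "Q x = (\<lambda>(n::nat, s). if n = 0 then return_pmf x else K s)" for x
  define P where "P x = PiM UNIV (\<lambda>i. measure_pmf (Q x i))" for x
  define X :: "nat \<Rightarrow> (nat \<times> 'a \<Rightarrow> 'a) \<Rightarrow> 'a" where
    "X = rec_nat (\<lambda>\<omega>. \<omega> (0, undefined)) (\<lambda>n Xn \<omega>. \<omega> (Suc n, Xn \<omega>))"
  have X0: "X 0 \<omega> = \<omega> (0, undefined)" and XS: "X (Suc n) \<omega> = \<omega> (Suc n, X n \<omega>)" for n and \<omega> :: "nat \<times> 'a \<Rightarrow> 'a"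
    by (simp_all add: X_def)
  have "markov_chain_from (P x) p x X" for x
  proof -
    interpret product_prob_space "\<lambda>i. measure_pmf (Q x i)" UNIV
      by unfold_locales
    interpret PP: prob_space "P x"
      unfolding P_def by (rule prob_space_PiM) (rule prob_space_measure_pmf)
    have sp: "space (P x) = UNIV"
      by (simp add: P_def space_PiM)
    have comp: "(\<lambda>\<omega>. \<omega> i) \<in> P x \<rightarrow>\<^sub>M count_space UNIV" for i
      unfolding P_def using measurable_component_singleton[of i UNIV "\<lambda>i. measure_pmf (Q x i)"]
      by simp
    have meas: "X n \<in> P x \<rightarrow>\<^sub>M count_space UNIV" for n
    proof (induction n)
      case 0
      then show ?case using comp by (simp add: X_def)
    next
      case (Suc n)
      have "(\<lambda>\<omega>. \<omega> (Suc n, X n \<omega>)) \<in> P x \<rightarrow>\<^sub>M count_space UNIV"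
        by (rule measurable_compose_countable[where f = "\<lambda>s \<omega>. \<omega> (Suc n, s)", OF comp Suc])
      then show ?case by (simp add: X_def)
    qed
    define idx where "idx s k = (k, case k of 0 \<Rightarrow> undefined | Suc m \<Rightarrow> s m)" for s :: "nat \<Rightarrow> 'a" and k
    have inj: "inj (idx s)" for s
      by (auto simp: inj_def idx_def)
    have all_Suc: "(\<forall>k\<le>Suc n. R k) \<longleftrightarrow> (\<forall>k\<le>n. R k) \<and> R (Suc n)" for R n
      by (auto simp: le_Suc_eq)
    have hist: "(\<forall>k\<le>n. X k \<omega> = s k) \<longleftrightarrow> (\<forall>k\<le>n. \<omega> (idx s k) = s k)" for n s \<omega>
    proof (induction n)
      case 0
      then show ?case by (simp add: X0 idx_def)
    next
      case (Suc n)
      have "(\<forall>k\<le>Suc n. X k \<omega> = s k) \<longleftrightarrow> (\<forall>k\<le>n. X k \<omega> = s k) \<and> \<omega> (Suc n, s n) = s (Suc n)"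
        unfolding all_Suc XS by auto
      also have "\<dots> \<longleftrightarrow> (\<forall>k\<le>Suc n. \<omega> (idx s k) = s k)"
        unfolding Suc all_Suc by (simp add: idx_def)
      finally show ?case .
    qed
    have prob: "\<P>(\<omega> in P x. \<forall>k\<le>n. X k \<omega> = s k) = (\<Prod>k\<le>n. pmf (Q x (idx s k)) (s k))" for n s
    proof -
      have "{\<omega> \<in> space (P x). \<forall>k\<le>n. X k \<omega> = s k} =
          prod_emb UNIV (\<lambda>i. measure_pmf (Q x i)) (idx s ` {..n}) (PiE (idx s ` {..n}) (\<lambda>i. {s (fst i)}))"
        unfolding hist by (auto simp: sp prod_emb_def PiE_def Pi_def space_PiM idx_def)
      then have "\<P>(\<omega> in P x. \<forall>k\<le>n. X k \<omega> = s k) =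
          (\<Prod>i\<in>idx s ` {..n}. measure (measure_pmf (Q x i)) {s (fst i)})"
        unfolding P_def by (simp add: measure_PiM_emb)
      also have "\<dots> = (\<Prod>k\<le>n. pmf (Q x (idx s k)) (s k))"
        using inj[of s] by (subst prod.reindex) (auto intro: inj_on_subset simp: measure_pmf_single idx_def)
      finally show ?thesis .
    qed
    have "\<P>(\<omega> in P x. X (Suc n) \<omega> = y \<bar> \<forall>k\<le>n. X k \<omega> = s k) = p (s n) y"
      if "\<P>(\<omega> in P x. \<forall>k\<le>n. X k \<omega> = s k) > 0" for n s y
    proof -
      let ?s = "s(Suc n := y)"
      have "\<P>(\<omega> in P x. X (Suc n) \<omega> = y \<and> (\<forall>k\<le>n. X k \<omega> = s k)) = \<P>(\<omega> in P x. \<forall>k\<le>Suc n. X k \<omega> = ?s k)"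
        by (rule arg_cong[where f = "measure (P x)"]) (auto simp: le_Suc_eq)
      also have "\<dots> = (\<Prod>k\<le>n. pmf (Q x (idx ?s k)) (?s k)) * pmf (Q x (idx ?s (Suc n))) y"
        by (simp only: prob prod.atMost_Suc fun_upd_same)
      also have "(\<Prod>k\<le>n. pmf (Q x (idx ?s k)) (?s k)) = (\<Prod>k\<le>n. pmf (Q x (idx s k)) (s k))"
        by (rule prod.cong) (auto simp: idx_def split: nat.split)
      also have "pmf (Q x (idx ?s (Suc n))) y = p (s n) y"
        by (simp add: idx_def Q_def K)
      finally show ?thesis
        using that unfolding cond_prob_def prob
        by (simp only: nonzero_mult_div_cancel_left[OF less_imp_neq[THEN not_sym]])
    qed
    moreover have "AE \<omega> in P x. X 0 \<omega> = x"
    proof -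
      have "\<P>(\<omega> in P x. \<forall>k\<le>0. X k \<omega> = x) = 1"
        by (subst prob) (simp add: Q_def idx_def)
      then show ?thesis
        using PP.prob_Collect_eq_1[of "\<lambda>\<omega>. X 0 \<omega> = x"] meas[of 0] by simp
    qed
    ultimately show ?thesis
      unfolding markov_chain_from_def by (intro conjI allI impI meas PP.prob_space_axioms) assumption+
  qed
  then show ?thesis by blast
qed

end

theory Submission
  imports Defs
begin

text \<open>
  Write \<open>D = lam + a1 + a2\<close>, \<open>R = lam D - \<mu> (a1 + a2)\<close> and \<open>Fk = lam (lk + ak) - \<mu> ak\<close>. The disjunction
  of the three conditions is equivalent to \<open>R < 0\<close>, \<open>F1 < 0\<close> and \<open>F2 < 0\<close> holding together.
  If one of these inequalities fails, one of the linear functions \<open>i + j\<close>, \<open>(lam + a1) i + a1 j\<close>,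
  \<open>a2 i + (lam + a2) j\<close> has nonnegative drift at every state, and a chain with such a function,
  bounded jumps and positive values outside the origin has infinite mean return time to the origin.
  If all three hold, the function \<open>(i + j)\<^sup>2 + \<kappa> (i - j)\<^sup>2\<close> with \<open>\<kappa> = lam / (lam + 2 a1)\<close> for
  \<open>i \<ge> j\<close> and \<open>\<kappa> = lam / (lam + 2 a2)\<close> for \<open>i < j\<close> has drift at most \<open>2 - 2 e (i + j)\<close> for some
  \<open>e > 0\<close>, and Foster's criterion applies.
\<close>

section \<open>Killed chains and mean return times\<close>

text \<open>
  The operator \<open>taboo K s\<close> is the transition operator killed on entering \<open>s\<close>, so that
  \<open>survival K s n x\<close> is the probability, starting from \<open>x\<close>, of not visiting \<open>s\<close> at times \<open>1, \<dots>, n\<close>.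
\<close>

definition taboo :: "('a \<Rightarrow> 'a pmf) \<Rightarrow> 'a \<Rightarrow> ('a \<Rightarrow> ennreal) \<Rightarrow> 'a \<Rightarrow> ennreal" where
  "taboo K s f x = (\<integral>\<^sup>+ y. (if y = s then 0 else f y) \<partial>measure_pmf (K x))"

lemma taboo_mono: "(\<And>x. f x \<le> g x) \<Longrightarrow> taboo K s f x \<le> taboo K s g x"
  unfolding taboo_def by (intro nn_integral_mono) auto

lemma taboo_add: "taboo K s (\<lambda>x. f x + g x) x = taboo K s f x + taboo K s g x"
  unfolding taboo_def by (subst nn_integral_add[symmetric]) (auto intro!: nn_integral_cong)

lemma taboo_cmult: "taboo K s (\<lambda>x. c * f x) x = c * taboo K s f x"
  unfolding taboo_def by (subst nn_integral_cmult[symmetric]) (auto intro!: nn_integral_cong)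

lemma taboo_suminf: "taboo K s (\<lambda>x. \<Sum>n. f n x) x = (\<Sum>n. taboo K s (f n) x)"
  unfolding taboo_def by (subst nn_integral_suminf[symmetric]) (auto intro!: nn_integral_cong)

lemma taboo_sum: "taboo K s (\<lambda>x. \<Sum>k<n. f k x) x = (\<Sum>k<n. taboo K s (f k) x)"
  unfolding taboo_def by (subst nn_integral_sum[symmetric]) (auto intro!: nn_integral_cong)

lemma taboo_le: "taboo K s f x \<le> (\<integral>\<^sup>+ y. f y \<partial>measure_pmf (K x))"
  unfolding taboo_def by (intro nn_integral_mono) auto

definition survival :: "('a \<Rightarrow> 'a pmf) \<Rightarrow> 'a \<Rightarrow> nat \<Rightarrow> 'a \<Rightarrow> ennreal" where
  "survival K s n = (taboo K s ^^ n) (\<lambda>_. 1)"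

lemma survival_0 [simp]: "survival K s 0 x = 1"
  by (simp add: survival_def)

lemma survival_Suc: "survival K s (Suc n) = taboo K s (survival K s n)"
  by (simp add: survival_def)

lemma survival_le_1: "survival K s n x \<le> 1"
proof (induction n arbitrary: x)
  case (Suc n)
  have "survival K s (Suc n) x \<le> (\<integral>\<^sup>+ y. 1 \<partial>measure_pmf (K x))"
    unfolding survival_Suc by (rule order_trans[OF taboo_le]) (intro nn_integral_mono Suc)
  then show ?case by simp
qed simp

lemma survival_decseq: "survival K s (Suc n) x \<le> survival K s n x"
proof (induction n arbitrary: x)
  case 0
  then show ?case using survival_le_1[of K s "Suc 0" x] by simp
next
  case (Suc n)
  then show ?case unfolding survival_Suc[of K s "Suc n"] survival_Suc[of K s n]
    by (intro taboo_mono) (simp add: survival_Suc)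
qed

lemma survival_antimono: "m \<le> n \<Longrightarrow> survival K s n x \<le> survival K s m x"
  by (rule lift_Suc_antimono_le[of "\<lambda>n. survival K s n x"]) (rule survival_decseq)

text \<open>Tail-sum formula for the mean of the first return time to \<open>s\<close>, started in
  \<open>x\<close>.\<close>

definition mean_return :: "('a \<Rightarrow> 'a pmf) \<Rightarrow> 'a \<Rightarrow> 'a \<Rightarrow> ennreal" where
  "mean_return K s x = (\<Sum>n. survival K s n x)"

text \<open>First-step decomposition: the partial sum is the mean of the return time truncated at
  \<open>Suc n\<close>, and the leading 1 counts the first step.\<close>

lemma sum_survival_Suc:
  "(\<Sum>k<Suc n. survival K s k x) = 1 + taboo K s (\<lambda>y. \<Sum>k<n. survival K s k y) x"
  by (simp only: sum.lessThan_Suc_shift taboo_sum survival_Suc survival_0)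

text \<open>A supersolution of the first-step equation dominates every truncated mean, by induction
  on the truncation level, and hence their limit.\<close>

lemma mean_return_le:
  assumes "\<And>x. taboo K s W x + 1 \<le> W x"
  shows "mean_return K s x \<le> W x"
proof -
  have "(\<Sum>k<n. survival K s k x) \<le> W x" for n x
  proof (induction n arbitrary: x)
    case (Suc n)
    have "(\<Sum>k<Suc n. survival K s k x) \<le> 1 + taboo K s W x"
      unfolding sum_survival_Suc by (intro add_left_mono taboo_mono Suc)
    also have "\<dots> \<le> W x" using assms[of x] by (simp add: add.commute)
    finally show ?case .
  qed simp
  then show ?thesis
    unfolding mean_return_def by (intro suminf_le_const) auto
qed

text \<open>Carries the possibility of reaching \<open>s\<close> backwards along one transition;
  iterated along a path it shows that \<open>s\<close> can be hit.\<close>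

lemma survival_less_1_step:
  assumes "y \<in> set_pmf (K x)" "y = s \<or> survival K s n y < 1"
  shows "survival K s (Suc n) x < 1"
proof -
  define f where "f z = (if z = s then 0 else survival K s n z)" for z
  have le: "f z \<le> 1" for z by (simp add: f_def survival_le_1)
  have "f y < 1" using assms by (auto simp: f_def)
  have "(\<integral>\<^sup>+ z. f z \<partial>measure_pmf (K x)) < (\<integral>\<^sup>+ z. 1 \<partial>measure_pmf (K x))"
  proof (rule nn_integral_less)
    have "(\<integral>\<^sup>+ z. f z \<partial>measure_pmf (K x)) \<le> (\<integral>\<^sup>+ z. 1 \<partial>measure_pmf (K x))"
      by (intro nn_integral_mono le)
    then show "(\<integral>\<^sup>+ z. f z \<partial>measure_pmf (K x)) \<noteq> \<infinity>"
      by (auto simp: top_unique)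
    show "\<not> (AE z in measure_pmf (K x). 1 \<le> f z)"
      using \<open>f y < 1\<close> assms(1) by (auto simp: AE_measure_pmf_iff not_le)
  qed (auto simp: le)
  then show ?thesis
    by (simp add: survival_Suc taboo_def f_def)
qed

text \<open>
  Foster's criterion. To \<open>V\<close> one adds a multiple of the truncated mean hitting time
  \<open>g = (\<Sum>k<N. survival K s k)\<close>: it never increases under \<open>taboo K s\<close>, and on \<open>F\<close> it decreases by
  at least \<open>d > 0\<close>, which compensates for the exceptional set.
\<close>

lemma mean_return_finite:
  fixes V :: "'a \<Rightarrow> ennreal"
  assumes V: "\<And>x. V x < \<infinity>" and B: "B < \<infinity>" and F: "finite F"
    and out: "\<And>x. x \<notin> F \<Longrightarrow> (\<integral>\<^sup>+ y. V y \<partial>measure_pmf (K x)) + 1 \<le> V x"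
    and ins: "\<And>x. x \<in> F \<Longrightarrow> (\<integral>\<^sup>+ y. V y \<partial>measure_pmf (K x)) + 1 \<le> V x + B"
    and hit: "\<And>x. \<exists>n. survival K s n x < 1"
  shows "mean_return K s x < \<infinity>"
proof -
  obtain m where m: "survival K s (m x) x < 1" for x
    using hit by metis
  \<comment> \<open>Survival is antitone in time and \<open>F\<close> is finite, so one horizon
    serves all of \<open>F\<close>.\<close>
  define N where "N = Max (insert 0 (m ` F))"
  have sN: "survival K s N x < 1" if "x \<in> F" for x
  proof -
    have "m x \<le> N" unfolding N_def using F that by simp
    then show ?thesis using survival_antimono m le_less_trans by metis
  qed
  obtain d :: real where d: "d > 0" "d \<le> 1" "\<And>x. x \<in> F \<Longrightarrow> survival K s N x \<le> ennreal (1 - d)"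
  proof -
    define b where "b = Max (insert 0 ((\<lambda>x. enn2real (survival K s N x)) ` F))"
    have r: "0 \<le> enn2real (survival K s N x)" "enn2real (survival K s N x) < 1"
      "survival K s N x = ennreal (enn2real (survival K s N x))" if "x \<in> F" for x
      using sN[OF that] by (cases "survival K s N x"; simp)+
    have b: "0 \<le> b" "b < 1"
      unfolding b_def using F r by auto
    show thesis
    proof (rule that[of "1 - b"])
      fix x assume x: "x \<in> F"
      have "enn2real (survival K s N x) \<le> b"
        unfolding b_def using F x by simp
      then show "survival K s N x \<le> ennreal (1 - (1 - b))"
        using r(3)[OF x] by (metis add_diff_cancel_left' ennreal_leI diff_add_cancel add.commute)
    qed (use b in auto)
  qed
  define g where "g x = (\<Sum>k<N. survival K s k x)" for x
  have g: "taboo K s g x + 1 = g x + survival K s N x" for x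
    using sum_survival_Suc[of K s x N] unfolding g_def by (simp add: add.commute)
  have g_le: "taboo K s g x \<le> g x" for x
  proof -
    have "taboo K s g x + 1 \<le> g x + 1"
      unfolding g by (intro add_left_mono survival_le_1)
    then show ?thesis by simp
  qed
  have g_ins: "taboo K s g x + ennreal d \<le> g x" if "x \<in> F" for x
  proof -
    have "taboo K s g x + ennreal d + ennreal (1 - d) = taboo K s g x + 1"
      using d by (simp add: add.assoc ennreal_plus[symmetric] del: ennreal_plus)
    also have "\<dots> \<le> g x + ennreal (1 - d)"
      unfolding g by (intro add_left_mono d that)
    finally show ?thesis by simp
  qed
  have g_fin: "g x < \<infinity>" for x
  proof -
    have "g x \<le> (\<Sum>k<N. 1)" unfolding g_def by (intro sum_mono survival_le_1)
    also have "\<dots> < \<infinity>" by (simp add: of_nat_less_top)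
    finally show ?thesis .
  qed
  \<comment> \<open>Chosen so that the gain \<open>C * ennreal d\<close> on \<open>F\<close> cancels
    the excess \<open>B\<close> exactly.\<close>
  define C where "C = B * ennreal (1 / d)"
  have Cd: "C * ennreal d = B"
    using d by (simp add: C_def mult.assoc ennreal_mult[symmetric])
  have C_fin: "C < \<infinity>" using B by (simp add: C_def ennreal_mult_less_top)
  define W where "W x = V x + C * g x" for x
  have "taboo K s W x + 1 \<le> W x" for x
  proof -
    have *: "taboo K s W x + 1 \<le> (\<integral>\<^sup>+ y. V y \<partial>measure_pmf (K x)) + 1 + C * taboo K s g x"
    proof -
      have "taboo K s W x = taboo K s V x + C * taboo K s g x"
        unfolding W_def taboo_add taboo_cmult ..
      then show ?thesis using taboo_le[of K s V x]
        by (simp add: add.assoc add.commute[of 1])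
    qed
    show ?thesis
    proof (cases "x \<in> F")
      case True
      note *
      also have "(\<integral>\<^sup>+ y. V y \<partial>measure_pmf (K x)) + 1 + C * taboo K s g x \<le> V x + B + C * taboo K s g x"
        by (intro add_right_mono ins True)
      also have "\<dots> = V x + C * (taboo K s g x + ennreal d)"
        using Cd by (simp add: distrib_left add_ac)
      also have "\<dots> \<le> W x"
        unfolding W_def by (intro add_left_mono mult_left_mono g_ins True) simp
      finally show ?thesis .
    next
      case False
      note *
      also have "(\<integral>\<^sup>+ y. V y \<partial>measure_pmf (K x)) + 1 + C * taboo K s g x \<le> V x + C * g x"
        by (intro add_mono out False mult_left_mono g_le) simp
      finally show ?thesis unfolding W_def .
    qed
  qed
  from mean_return_le[of K s W, OF this] have "mean_return K s x \<le> W x" .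
  also have "W x < \<infinity>"
    unfolding W_def using V g_fin C_fin by (simp add: ennreal_mult_less_top)
  finally show ?thesis .
qed

text \<open>As \<open>h\<close> falls by at most 1 per transition and is 0 at \<open>s\<close>,
  every path from \<open>x\<close> to \<open>s\<close> takes at least \<open>h x\<close>
  steps.\<close>

lemma mean_return_ge:
  fixes h :: "'a \<Rightarrow> ennreal"
  assumes h: "h s = 0" "h x < \<infinity>" and lip: "\<And>x y. y \<in> set_pmf (K x) \<Longrightarrow> h x \<le> h y + 1"
  shows "h x \<le> mean_return K s x"
proof -
  \<comment> \<open>Truncating \<open>h\<close> at \<open>n\<close> permits induction along the
    partial sums; finiteness of \<open>h x\<close> later removes the truncation.\<close>
  have *: "min (h x) (of_nat n) \<le> (\<Sum>k<n. survival K s k x)" for n x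
  proof (induction n arbitrary: x)
    case (Suc n)
    have "min (h x) (of_nat (Suc n)) = (\<integral>\<^sup>+ y. min (h x) (of_nat (Suc n)) \<partial>measure_pmf (K x))"
      by simp
    also have "\<dots> \<le> (\<integral>\<^sup>+ y. (if y = s then 0 else \<Sum>k<n. survival K s k y) + 1 \<partial>measure_pmf (K x))"
    proof (rule nn_integral_mono_AE, unfold AE_measure_pmf_iff, rule ballI)
      fix y assume "y \<in> set_pmf (K x)"
      then have "min (h x) (of_nat (Suc n)) \<le> min (h y) (of_nat n) + 1"
        using lip[of y x] by (auto simp: min_def add.commute split: if_splits intro: order_trans)
      also have "\<dots> \<le> (if y = s then 0 else \<Sum>k<n. survival K s k y) + 1"
        using Suc[of y] h(1) by auto
      finally show "min (h x) (of_nat (Suc n)) \<le> (if y = s then 0 else \<Sum>k<n. survival K s k y) + 1" .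
    qed
    also have "\<dots> = (\<Sum>k<Suc n. survival K s k x)"
      unfolding sum_survival_Suc taboo_def by (subst nn_integral_add) (auto simp: add.commute)
    finally show ?case .
  qed simp
  obtain n :: nat where n: "h x \<le> of_nat n"
    using h(2) ennreal_Ex_less_of_nat[of "h x"] by (auto intro: less_imp_le)
  have "h x = min (h x) (of_nat n)" using n by (simp add: min_def)
  also have "\<dots> \<le> mean_return K s x"
    unfolding mean_return_def by (rule order_trans[OF *]) (intro sum_le_suminf, auto)
  finally show ?thesis .
qed

text \<open>
  If the mean return time were finite, then \<open>h \<le> mean_return K s\<close> would force the \<open>n\<close>-th taboo
  iterate of \<open>h\<close> at \<open>s\<close> to be at most the tail of a convergent series, but these iterates do not
  decrease in \<open>n\<close>.
\<close>

lemma mean_return_infinite: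
  fixes h :: "'a \<Rightarrow> ennreal"
  assumes h: "h s = 0" "\<And>x. h x < \<infinity>" and lip: "\<And>x y. y \<in> set_pmf (K x) \<Longrightarrow> h x \<le> h y + 1"
    and sub: "\<And>x. h x \<le> (\<integral>\<^sup>+ y. h y \<partial>measure_pmf (K x))"
    and pos: "0 < (\<integral>\<^sup>+ y. h y \<partial>measure_pmf (K s))"
  shows "mean_return K s s = \<infinity>"
proof (rule ccontr)
  assume fin: "mean_return K s s \<noteq> \<infinity>"
  have t: "taboo K s h x = (\<integral>\<^sup>+ y. h y \<partial>measure_pmf (K x))" for x
    unfolding taboo_def using h(1) by (intro nn_integral_cong) auto
  have mono: "(taboo K s ^^ n) f x \<le> (taboo K s ^^ n) g x" if "\<And>x. f x \<le> g x" for n f g x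
    using that by (induction n arbitrary: x) (auto intro: taboo_mono)
  \<comment> \<open>Killing at \<open>s\<close> loses nothing because \<open>h s = 0\<close>, so the
    submartingale inequality iterates.\<close>
  have lower: "taboo K s h x \<le> (taboo K s ^^ Suc n) h x" for n x
  proof (induction n arbitrary: x)
    case (Suc n)
    have "h x \<le> (taboo K s ^^ Suc n) h x" for x
      using sub[of x] Suc[of x] unfolding t by (rule order_trans)
    then show ?case
      unfolding funpow.simps(2)[of "Suc n"] o_def by (rule taboo_mono)
  qed simp
  have upper: "(taboo K s ^^ n) (mean_return K s) x = (\<Sum>k. survival K s (k + n) x)" for n x
  proof (induction n arbitrary: x)
    case 0
    then show ?case by (simp add: mean_return_def)
  next
    case (Suc n)
    have "(taboo K s ^^ Suc n) (mean_return K s) x = taboo K s (\<lambda>x. \<Sum>k. survival K s (k + n) x) x"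
      by (simp add: Suc[abs_def])
    also have "\<dots> = (\<Sum>k. survival K s (k + Suc n) x)"
      unfolding taboo_suminf by (simp add: survival_Suc)
    finally show ?case .
  qed
  define r where "r n = enn2real (survival K s n s)" for n
  have r: "survival K s n s = ennreal (r n)" "r n \<ge> 0" for n
    using survival_le_1[of K s n s] unfolding r_def by (cases "survival K s n s"; simp add: top_unique)+
  have summ: "summable r"
    by (rule summable_suminf_not_top) (use r fin in \<open>auto simp: mean_return_def\<close>)
  have le: "taboo K s h s \<le> ennreal (\<Sum>k. r (k + Suc n))" for n
  proof -
    have "taboo K s h s \<le> (taboo K s ^^ Suc n) h s" by (rule lower)
    also have "\<dots> \<le> (taboo K s ^^ Suc n) (mean_return K s) s"
      by (intro mono mean_return_ge h lip)
    also have "\<dots> = (\<Sum>k. ennreal (r (k + Suc n)))" unfolding upper r ..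
    also have "\<dots> = ennreal (\<Sum>k. r (k + Suc n))"
      by (rule suminf_ennreal2) (use r summ in \<open>auto simp only: summable_iff_shift\<close>)
    finally show ?thesis .
  qed
  have "(\<lambda>n. \<Sum>k. r (k + n)) \<longlonglongrightarrow> 0"
    by (rule suminf_exist_split2[OF summ])
  then have "(\<lambda>n. \<Sum>k. r (k + Suc n)) \<longlonglongrightarrow> 0"
    by (rule LIMSEQ_Suc)
  then have "(\<lambda>n. ennreal (\<Sum>k. r (k + Suc n))) \<longlonglongrightarrow> ennreal 0"
    by (rule tendsto_ennrealI)
  then have "taboo K s h s \<le> ennreal 0"
    by (rule LIMSEQ_le_const) (use le in blast)
  then show False using pos unfolding t by simp
qed

section \<open>Return times of a Markov chain\<close>

text \<open>The summand with index \<open>n\<close> is 1 exactly if no return has happened up to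
  time \<open>n\<close>; for \<open>n = 0\<close> the range is empty, and without any return all
  terms are 1.\<close>

lemma return_time_eq_suminf:
  "return_time X s \<omega> = (\<Sum>n. if \<forall>k\<in>{1..n}. X k \<omega> \<noteq> s then 1 else 0)"
proof (cases "\<exists>n\<ge>1. X n \<omega> = s")
  case False
  then have "{n. 1 \<le> n \<and> X n \<omega> = s} = {}" by auto
  moreover have "(\<forall>k\<in>{1..n}. X k \<omega> \<noteq> s) \<longleftrightarrow> True" for n using False by auto
  moreover have "(\<Sum>n::nat. 1 :: ennreal) = \<infinity>"
    using nn_integral_count_space_nat[of "\<lambda>_. 1"] by simp
  ultimately show ?thesis by (simp add: return_time_def)
next
  case True
  define T where "T = (LEAST n. 1 \<le> n \<and> X n \<omega> = s)"
  have T: "1 \<le> T" "X T \<omega> = s" "\<And>n. 1 \<le> n \<Longrightarrow> X n \<omega> = s \<Longrightarrow> T \<le> n"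
    using LeastI_ex[OF True] Least_le[of "\<lambda>n. 1 \<le> n \<and> X n \<omega> = s"] unfolding T_def by auto
  have "return_time X s \<omega> = of_nat T"
    unfolding return_time_def
    by (rule antisym) (use T in \<open>auto intro!: INF_lower INF_greatest\<close>)
  moreover have "(\<forall>k\<in>{1..n}. X k \<omega> \<noteq> s) \<longleftrightarrow> n \<in> {..<T}" for n
    using T by (force simp: not_less)
  moreover have "(\<Sum>n. if n \<in> {..<T} then 1 else 0 :: ennreal) = of_nat T"
    by (subst suminf_finite[of "{..<T}"]) auto
  ultimately show ?thesis by simp
qed

text \<open>The Markov property integrated over an arbitrary event \<open>Q\<close> of the history.
  The definition of the chain speaks of single histories, but these form a countable type of lists,
  so one can sum over them.\<close>

lemma markov_chain_from_step:
  fixes X :: "nat \<Rightarrow> 'w \<Rightarrow> 'a::countable" and g :: "'a \<Rightarrow> ennreal"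
  assumes M: "markov_chain_from M (\<lambda>x y. pmf (K x) y) x X"
  shows "(\<integral>\<^sup>+ \<omega>. (if Q (map (\<lambda>k. X k \<omega>) [0..<Suc n]) then g (X (Suc n) \<omega>) else 0) \<partial>M) =
    (\<integral>\<^sup>+ \<omega>. (if Q (map (\<lambda>k. X k \<omega>) [0..<Suc n]) then \<integral>\<^sup>+ y. g y \<partial>measure_pmf (K (X n \<omega>)) else 0) \<partial>M)"
proof -
  define Y where "Y \<omega> = map (\<lambda>k. X k \<omega>) [0..<Suc n]" for \<omega>
  interpret prob_space M using M by (simp add: markov_chain_from_def)
  have X[measurable]: "X k \<in> M \<rightarrow>\<^sub>M count_space UNIV" for k
    using M by (simp add: markov_chain_from_def)
  have Y_iff: "Y \<omega> = l \<longleftrightarrow> length l = Suc n \<and> (\<forall>k\<le>n. X k \<omega> = l ! k)" for \<omega> l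
    unfolding Y_def list_eq_iff_nth_eq by (auto simp: less_Suc_eq_le simp del: upt_Suc)
  have Y[measurable]: "Y \<in> M \<rightarrow>\<^sub>M count_space UNIV"
  proof (rule measurable_count_space_eq2_countable[THEN iffD2], safe)
    fix l
    have "Y -` {l} \<inter> space M = {\<omega> \<in> space M. length l = Suc n \<and> (\<forall>k\<le>n. X k \<omega> = l ! k)}"
      using Y_iff by auto
    then show "Y -` {l} \<inter> space M \<in> sets M" by simp
  qed auto
  have last: "X n \<omega> = last (Y \<omega>)" for \<omega> by (simp add: Y_def)
  \<comment> \<open>The conditional probability as a product formula, which also covers histories of
    probability 0, where both sides vanish.\<close>
  have cond: "emeasure M {\<omega> \<in> space M. Y \<omega> = l \<and> X (Suc n) \<omega> = y} =
      emeasure M {\<omega> \<in> space M. Y \<omega> = l} * ennreal (pmf (K (last l)) y)" for l y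
  proof (cases "prob {\<omega> \<in> space M. Y \<omega> = l} > 0")
    case True
    have "length l = Suc n"
    proof (rule ccontr)
      assume "length l \<noteq> Suc n"
      then have "{\<omega> \<in> space M. Y \<omega> = l} = {}" using Y_iff by auto
      then show False using True by (metis measure_empty less_irrefl)
    qed
    then have Yl: "Y \<omega> = l \<longleftrightarrow> (\<forall>k\<le>n. X k \<omega> = l ! k)" and ll: "last l = l ! n" for \<omega>
      using Y_iff last_conv_nth[of l] by (cases l; auto)+
    have "\<P>(\<omega> in M. X (Suc n) \<omega> = y \<bar> \<forall>k\<le>n. X k \<omega> = l ! k) = pmf (K (l ! n)) y"
      using M True unfolding markov_chain_from_def Yl by blast
    then have "prob {\<omega> \<in> space M. X (Suc n) \<omega> = y \<and> Y \<omega> = l} = prob {\<omega> \<in> space M. Y \<omega> = l} * pmf (K (last l)) y"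
      using True unfolding cond_prob_def Yl ll by (simp add: field_simps)
    then show ?thesis
      by (simp add: emeasure_eq_measure ennreal_mult[symmetric] conj_commute)
  next
    case False
    then have 0: "prob {\<omega> \<in> space M. Y \<omega> = l} = 0"
      using measure_nonneg[of M] by (simp add: not_less antisym)
    have "prob {\<omega> \<in> space M. Y \<omega> = l \<and> X (Suc n) \<omega> = y} \<le> prob {\<omega> \<in> space M. Y \<omega> = l}"
      by (intro finite_measure_mono) auto
    then have "prob {\<omega> \<in> space M. Y \<omega> = l \<and> X (Suc n) \<omega> = y} = 0"
      unfolding 0 using measure_nonneg[of M] by (simp add: antisym)
    then show ?thesis using 0 by (simp add: emeasure_eq_measure)
  qed
  have decomp: "(\<integral>\<^sup>+ \<omega>. f (Z \<omega>) \<partial>M) = (\<integral>\<^sup>+ z. f z * emeasure M {\<omega> \<in> space M. Z \<omega> = z} \<partial>count_space UNIV)"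
    if [measurable]: "Z \<in> M \<rightarrow>\<^sub>M count_space UNIV" for Z :: "'w \<Rightarrow> 'b::countable" and f
  proof -
    have "(\<integral>\<^sup>+ \<omega>. f (Z \<omega>) \<partial>M) = (\<integral>\<^sup>+ \<omega>. (\<integral>\<^sup>+ z. f z * indicator {z} (Z \<omega>) \<partial>count_space UNIV) \<partial>M)"
    proof (intro nn_integral_cong)
      fix \<omega>
      have "(\<integral>\<^sup>+ z. f z * indicator {z} (Z \<omega>) \<partial>count_space UNIV) =
          (\<integral>\<^sup>+ z. f z * indicator {Z \<omega>} z \<partial>count_space UNIV)"
        by (intro nn_integral_cong) (auto simp: indicator_def)
      then show "f (Z \<omega>) = (\<integral>\<^sup>+ z. f z * indicator {z} (Z \<omega>) \<partial>count_space UNIV)"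
        by (simp add: nn_integral_indicator_singleton)
    qed
    also have "\<dots> = (\<integral>\<^sup>+ z. (\<integral>\<^sup>+ \<omega>. f z * indicator {z} (Z \<omega>) \<partial>M) \<partial>count_space UNIV)"
      by (rule nn_integral_count_space_nn_integral) auto
    also have "\<dots> = (\<integral>\<^sup>+ z. f z * emeasure M {\<omega> \<in> space M. Z \<omega> = z} \<partial>count_space UNIV)"
    proof (intro nn_integral_cong)
      fix z
      have "(\<integral>\<^sup>+ \<omega>. f z * indicator {z} (Z \<omega>) \<partial>M) = (\<integral>\<^sup>+ \<omega>. f z * indicator {\<omega> \<in> space M. Z \<omega> = z} \<omega> \<partial>M)"
        by (intro nn_integral_cong) (auto simp: indicator_def)
      then show "(\<integral>\<^sup>+ \<omega>. f z * indicator {z} (Z \<omega>) \<partial>M) = f z * emeasure M {\<omega> \<in> space M. Z \<omega> = z}"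
        by (simp add: nn_integral_cmult_indicator)
    qed
    finally show ?thesis .
  qed
  have YX: "(\<lambda>\<omega>. (Y \<omega>, X (Suc n) \<omega>)) \<in> M \<rightarrow>\<^sub>M count_space UNIV"
    by (auto simp: pair_measure_countable[symmetric] intro!: measurable_Pair)
  let ?G = "\<lambda>l. \<integral>\<^sup>+ y. g y \<partial>measure_pmf (K (last l))"
  have "(\<integral>\<^sup>+ \<omega>. (if Q (Y \<omega>) then g (X (Suc n) \<omega>) else 0) \<partial>M) =
      (\<integral>\<^sup>+ z. (if Q (fst z) then g (snd z) else 0) * emeasure M {\<omega> \<in> space M. (Y \<omega>, X (Suc n) \<omega>) = z} \<partial>count_space UNIV)"
    using decomp[OF YX, of "\<lambda>z. if Q (fst z) then g (snd z) else 0"] by (simp only: fst_conv snd_conv)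
  also have "\<dots> = (\<integral>\<^sup>+ z. (case z of (l, y) \<Rightarrow> (if Q l then emeasure M {\<omega> \<in> space M. Y \<omega> = l} else 0) *
      (ennreal (pmf (K (last l)) y) * g y)) \<partial>count_space UNIV)"
    by (intro nn_integral_cong) (auto simp: cond mult_ac split: prod.split)
  also have "\<dots> = (\<integral>\<^sup>+ l. (\<integral>\<^sup>+ y. (if Q l then emeasure M {\<omega> \<in> space M. Y \<omega> = l} else 0) *
      (ennreal (pmf (K (last l)) y) * g y) \<partial>count_space UNIV) \<partial>count_space UNIV)"
    by (subst nn_integral_fst_count_space[symmetric]) simp
  also have "\<dots> = (\<integral>\<^sup>+ l. (if Q l then ?G l else 0) * emeasure M {\<omega> \<in> space M. Y \<omega> = l} \<partial>count_space UNIV)"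
    by (intro nn_integral_cong) (simp add: nn_integral_cmult nn_integral_measure_pmf, simp add: mult.commute)
  also have "\<dots> = (\<integral>\<^sup>+ \<omega>. (if Q (Y \<omega>) then ?G (Y \<omega>) else 0) \<partial>M)"
    by (rule decomp[symmetric]) simp
  finally show ?thesis unfolding last by (simp only: Y_def)
qed

text \<open>The induction peels off the last transition and absorbs it into the integrand,
  \<open>g\<close> becoming \<open>taboo K s g\<close>; hence \<open>g\<close> is kept
  arbitrary.\<close>

lemma markov_chain_from_taboo:
  fixes X :: "nat \<Rightarrow> 'w \<Rightarrow> 'a::countable" and g :: "'a \<Rightarrow> ennreal"
  assumes M: "markov_chain_from M (\<lambda>x y. pmf (K x) y) x X"
  shows "(\<integral>\<^sup>+ \<omega>. (if \<forall>k\<in>{1..n}. X k \<omega> \<noteq> s then g (X n \<omega>) else 0) \<partial>M) = (taboo K s ^^ n) g x"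
proof (induction n arbitrary: g)
  case 0
  interpret prob_space M using M by (simp add: markov_chain_from_def)
  have "AE \<omega> in M. X 0 \<omega> = x" using M by (simp add: markov_chain_from_def)
  then have "AE \<omega> in M. g (X 0 \<omega>) = g x" by auto
  then have "(\<integral>\<^sup>+ \<omega>. g (X 0 \<omega>) \<partial>M) = (\<integral>\<^sup>+ \<omega>. g x \<partial>M)" by (rule nn_integral_cong_AE)
  then show ?case by (simp add: emeasure_space_1)
next
  case (Suc n)
  define Q where "Q l = (\<forall>k\<in>{1..n}. l ! k \<noteq> s)" for l :: "'a list"
  have Q: "Q (map (\<lambda>k. X k \<omega>) [0..<Suc n]) \<longleftrightarrow> (\<forall>k\<in>{1..n}. X k \<omega> \<noteq> s)" for \<omega>
    unfolding Q_def by (intro ball_cong) (auto simp del: upt_Suc)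
  have "(\<integral>\<^sup>+ \<omega>. (if \<forall>k\<in>{1..Suc n}. X k \<omega> \<noteq> s then g (X (Suc n) \<omega>) else 0) \<partial>M) =
    (\<integral>\<^sup>+ \<omega>. (if \<forall>k\<in>{1..n}. X k \<omega> \<noteq> s then (\<lambda>y. if y = s then 0 else g y) (X (Suc n) \<omega>) else 0) \<partial>M)"
    by (intro nn_integral_cong) (simp add: atLeastAtMostSuc_conv)
  also have "\<dots> = (\<integral>\<^sup>+ \<omega>. (if \<forall>k\<in>{1..n}. X k \<omega> \<noteq> s then taboo K s g (X n \<omega>) else 0) \<partial>M)"
    unfolding taboo_def
    by (rule markov_chain_from_step[OF M, of Q n "\<lambda>y. if y = s then 0 else g y", unfolded Q])
  also have "\<dots> = (taboo K s ^^ Suc n) g x"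
    unfolding Suc by (simp add: funpow_swap1)
  finally show ?case .
qed

lemma nn_integral_return_time:
  fixes X :: "nat \<Rightarrow> 'w \<Rightarrow> 'a::countable"
  assumes M: "markov_chain_from M (\<lambda>x y. pmf (K x) y) x X"
  shows "(\<integral>\<^sup>+ \<omega>. return_time X s \<omega> \<partial>M) = mean_return K s x"
proof -
  have X[measurable]: "X k \<in> M \<rightarrow>\<^sub>M count_space UNIV" for k
    using M by (simp add: markov_chain_from_def)
  show ?thesis
    unfolding return_time_eq_suminf mean_return_def survival_def markov_chain_from_taboo[OF M, symmetric]
    by (rule nn_integral_suminf) simp
qed

section \<open>Drifts of the shortest orbit queue chain\<close>

lemma nn_jump_simps [simp]:
  "nn_jump e n w s t (1, 0) = e" "nn_jump e n w s t (0, 1) = n" "nn_jump e n w s t (-1, 0) = w"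
  "nn_jump e n w s t (0, -1) = s" "nn_jump e n w s t (0, 0) = t"
  by (simp_all add: nn_jump_def)

text \<open>Truncated subtraction in \<open>i - 1\<close> and \<open>j - 1\<close> is harmless: on
  the axes the corresponding weight is 0.\<close>

lemma nn_integral_nn_jump:
  fixes f :: "nat \<times> nat \<Rightarrow> ennreal"
  assumes q: "\<And>k l. pmf q (k, l) = nn_jump e n w s t (int k - int i, int l - int j)"
    and nn: "0 \<le> e" "0 \<le> n" "0 \<le> w" "0 \<le> s" "0 \<le> t" and ax: "i = 0 \<Longrightarrow> w = 0" "j = 0 \<Longrightarrow> s = 0"
  shows "(\<integral>\<^sup>+ y. f y \<partial>measure_pmf q) = ennreal e * f (Suc i, j) + ennreal n * f (i, Suc j)
    + ennreal w * f (i - 1, j) + ennreal s * f (i, j - 1) + ennreal t * f (i, j)"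
proof -
  have *: "ennreal (pmf q y) * f y = ennreal e * f (Suc i, j) * indicator {(Suc i, j)} y
      + ennreal n * f (i, Suc j) * indicator {(i, Suc j)} y
      + ennreal w * f (i - 1, j) * indicator {(i - 1, j)} y
      + ennreal s * f (i, j - 1) * indicator {(i, j - 1)} y
      + ennreal t * f (i, j) * indicator {(i, j)} y" for y
  proof -
    obtain k l where y: "y = (k, l)" by (cases y)
    consider "k = Suc i" "l = j" | "k = i" "l = Suc j" | "i = Suc k" "l = j" | "k = i" "j = Suc l"
      | "k = i" "l = j"
      | "(int k - int i, int l - int j) \<notin> {(1, 0), (0, 1), (-1, 0), (0, -1), (0, 0)}"
      by force
    then show ?thesis
    proof cases
      \<comment> \<open>For \<open>i = 0\<close> or \<open>j = 0\<close> a truncated neighbour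
        coincides with \<open>(i, j)\<close> itself, and its zero weight prevents double
        counting.\<close>
      case 5
      then show ?thesis using ax by (cases "i = 0"; cases "j = 0") (auto simp: y q)
    next
      case 6
      then have "pmf q y = 0" by (auto simp: y q nn_jump_def)
      moreover have "y \<noteq> (Suc i, j)" "y \<noteq> (i, Suc j)" "w = 0 \<or> y \<noteq> (i - 1, j)" "s = 0 \<or> y \<noteq> (i, j - 1)" "y \<noteq> (i, j)"
        using 6 ax by (auto simp: y of_nat_diff)
      ultimately show ?thesis by (auto simp: indicator_def)
    qed (auto simp: y q)
  qed
  show ?thesis
    unfolding nn_integral_measure_pmf * by (simp add: nn_integral_add nn_integral_cmult_indicator)
qed

section \<open>The transition kernel and its rates\<close>

locale jsq =
  fixes l0 l1 l2 \<mu> a1 a2 :: real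
  assumes pos: "l0 > 0" "l1 > 0" "l2 > 0" "\<mu> > 0" "a1 > 0" "a2 > 0"
    and total: "l0 + l1 + l2 + \<mu> + a1 + a2 = 1"
begin

definition lam :: real where "lam = l0 + l1 + l2"

definition K :: "nat \<times> nat \<Rightarrow> (nat \<times> nat) pmf" where
  "K x = embed_pmf (jsq_trans l0 l1 l2 \<mu> a1 a2 x)"

lemma pmf_K: "pmf (K x) y = jsq_trans l0 l1 l2 \<mu> a1 a2 x y"
  unfolding K_def by (rule pmf_embed_pmf) (use pos total in \<open>auto intro: jsq_trans_stochastic\<close>)

definition east :: "nat \<Rightarrow> nat \<Rightarrow> real" where
  "east i j = (if i > j then l1 else if i < j then l0 + l1 else l0 / 2 + l1)"

definition north :: "nat \<Rightarrow> nat \<Rightarrow> real" where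
  "north i j = (if i > j then l0 + l2 else if i < j then l2 else l0 / 2 + l2)"

definition west :: "nat \<Rightarrow> nat \<Rightarrow> real" where
  "west i j = (if i = 0 then 0 else if j = 0 then \<mu> * a1 / (lam + a1) else \<mu> * a1 / (lam + a1 + a2))"

definition south :: "nat \<Rightarrow> nat \<Rightarrow> real" where
  "south i j = (if j = 0 then 0 else if i = 0 then \<mu> * a2 / (lam + a2) else \<mu> * a2 / (lam + a1 + a2))"

text \<open>Taken as the complement of the other rates, so the total mass is 1 by definition;
  \<open>jsq_jump_eq\<close> identifies it with the explicit holding probability.\<close>

definition stay :: "nat \<Rightarrow> nat \<Rightarrow> real" where
  "stay i j = 1 - (east i j + north i j + west i j + south i j)"

lemma lam_pos: "lam > 0"
  using pos by (simp add: lam_def)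

text \<open>After a service the server is taken by a retrial or by a fresh arrival, so these
  probabilities add up to \<open>\<mu>\<close>; this turns the holding probabilities into
  complements.\<close>

lemma service_le: "\<mu> * a1 / (lam + a1 + a2) + \<mu> * a2 / (lam + a1 + a2) + lam * \<mu> / (lam + a1 + a2) = \<mu>"
  "\<mu> * a1 / (lam + a1) + lam * \<mu> / (lam + a1) = \<mu>" "\<mu> * a2 / (lam + a2) + lam * \<mu> / (lam + a2) = \<mu>"
  using pos lam_pos by (simp_all add: divide_simps add_nonneg_eq_0_iff) (simp_all add: algebra_simps)

lemma jsq_jump_eq:
  "jsq_jump l0 l1 l2 \<mu> a1 a2 (i, j) = nn_jump (east i j) (north i j) (west i j) (south i j) (stay i j)"
proof -
  have "east i j + north i j = lam" by (simp add: east_def north_def lam_def)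
  then have stay: "stay i j = 1 - lam - west i j - south i j" by (simp add: stay_def)
  have one: "1 - lam = a1 + a2 + \<mu>" using total by (simp add: lam_def)
  show ?thesis
    unfolding stay one using service_le
    by (auto simp: jsq_jump_def Let_def lam_def[symmetric] east_def north_def west_def south_def
      intro!: arg_cong[where f = "nn_jump _ _ _ _"])
qed

lemma rates_nonneg: "0 \<le> east i j" "0 \<le> north i j" "0 \<le> west i j" "0 \<le> south i j" "0 \<le> stay i j"
proof -
  show "0 \<le> east i j" "0 \<le> north i j" "0 \<le> west i j" "0 \<le> south i j"
    using pos lam_pos by (simp_all add: east_def north_def west_def south_def)
  have "jsq_trans l0 l1 l2 \<mu> a1 a2 (i, j) (i, j) \<ge> 0"
    using pos total by (intro jsq_trans_stochastic) auto
  then show "0 \<le> stay i j" by (simp add: jsq_trans_def jsq_jump_eq)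
qed

lemma rates_pos: "0 < east i j" "0 < north i j" "0 < i \<Longrightarrow> 0 < west i j" "0 < j \<Longrightarrow> 0 < south i j"
  using pos lam_pos by (auto simp: east_def north_def west_def south_def)

lemma pmf_K_jump: "pmf (K (i, j)) (k, l) =
    nn_jump (east i j) (north i j) (west i j) (south i j) (stay i j) (int k - int i, int l - int j)"
  by (simp add: pmf_K jsq_trans_def jsq_jump_eq)

lemma nn_integral_K:
  fixes f :: "nat \<times> nat \<Rightarrow> ennreal"
  shows "(\<integral>\<^sup>+ y. f y \<partial>measure_pmf (K (i, j))) = ennreal (east i j) * f (Suc i, j) + ennreal (north i j) * f (i, Suc j)
    + ennreal (west i j) * f (i - 1, j) + ennreal (south i j) * f (i, j - 1) + ennreal (stay i j) * f (i, j)"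
  by (rule nn_integral_nn_jump[OF pmf_K_jump]) (rule rates_nonneg | simp add: west_def south_def)+

definition drift :: "(nat \<times> nat \<Rightarrow> real) \<Rightarrow> nat \<Rightarrow> nat \<Rightarrow> real" where
  "drift f i j = east i j * (f (Suc i, j) - f (i, j)) + north i j * (f (i, Suc j) - f (i, j))
    + west i j * (f (i - 1, j) - f (i, j)) + south i j * (f (i, j - 1) - f (i, j))"

lemma nn_integral_K_real:
  fixes f :: "nat \<times> nat \<Rightarrow> real"
  assumes "\<And>x. 0 \<le> f x"
  shows "(\<integral>\<^sup>+ y. ennreal (f y) \<partial>measure_pmf (K (i, j))) = ennreal (f (i, j) + drift f i j)"
proof -
  have "(\<integral>\<^sup>+ y. ennreal (f y) \<partial>measure_pmf (K (i, j))) = ennreal (east i j * f (Suc i, j) + north i j * f (i, Suc j)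
    + west i j * f (i - 1, j) + south i j * f (i, j - 1) + stay i j * f (i, j))"
    by (simp add: nn_integral_K rates_nonneg assms ennreal_mult ennreal_plus)
  also have "east i j * f (Suc i, j) + north i j * f (i, Suc j)
    + west i j * f (i - 1, j) + south i j * f (i, j - 1) + stay i j * f (i, j) = f (i, j) + drift f i j"
    by (simp add: drift_def stay_def algebra_simps)
  finally show ?thesis .
qed

lemma in_set_K: "(Suc i, j) \<in> set_pmf (K (i, j))" "(i, Suc j) \<in> set_pmf (K (i, j))"
  "(i, j) \<in> set_pmf (K (Suc i, j))" "(i, j) \<in> set_pmf (K (i, Suc j))"
  using rates_pos(1,2)[of i j] rates_pos(3)[of "Suc i" j] rates_pos(4)[of "Suc j" i]
  by (auto simp: set_pmf_iff pmf_K_jump)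

lemma set_K: "(k, l) \<in> set_pmf (K (i, j)) \<Longrightarrow>
    (k, l) \<in> {(Suc i, j), (i, Suc j), (i - 1, j), (i, j - 1), (i, j)}"
  by (auto simp: set_pmf_iff pmf_K_jump nn_jump_def split: if_splits)

text \<open>Irreducibility: the origin leads to \<open>s\<close> by increasing jumps, and every
  state leads to the origin by decreasing ones.\<close>

lemma survival_K_less_1: "\<exists>n. survival K s n x < 1"
proof -
  define R where "R x \<longleftrightarrow> x = s \<or> (\<exists>n. survival K s n x < 1)" for x
  have step: "\<exists>n. survival K s n x < 1" if "R y" "y \<in> set_pmf (K x)" for x y
    using survival_less_1_step[of y K x s] that unfolding R_def by metis
  then have R: "R x" if "R y" "y \<in> set_pmf (K x)" for x y
    using that unfolding R_def by metis
  obtain k l where s: "s = (k, l)" by (cases s)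
  have "R (k - m, l)" for m
  proof (induction m)
    case 0
    then show ?case by (simp add: R_def s)
  next
    case (Suc m)
    show ?case
    proof (cases "m < k")
      case True
      then have "k - m = Suc (k - Suc m)" by simp
      then show ?thesis using R[OF Suc] in_set_K(1)[of "k - Suc m" l] by simp
    next
      case False
      then show ?thesis using Suc by simp
    qed
  qed
  from this[of k] have "R (0, l)" by simp
  then have "R (0, l - m)" for m
  proof (induction m)
    case (Suc m)
    show ?case
    proof (cases "m < l")
      case True
      then have "l - m = Suc (l - Suc m)" by simp
      then show ?thesis using R[OF Suc.IH[OF Suc.prems]] in_set_K(2)[of 0 "l - Suc m"] by simp
    next
      case False
      then show ?thesis using Suc by simp
    qed
  qed simp
  from this[of l] have "R (0, 0)" by simp
  then have "R (i, 0)" for i by (induction i) (auto intro: R in_set_K)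
  then have "R (i, j)" for i j by (induction j) (auto intro: R in_set_K)
  \<comment> \<open>\<open>R\<close> holds trivially at \<open>s\<close>, so the bound at
    \<open>x\<close> is drawn from the neighbour \<open>(Suc i, j)\<close>, which also covers
    \<open>x = s\<close>.\<close>
  then show ?thesis using step[OF _ in_set_K(1)] by (cases x) auto
qed

text \<open>Applies \<open>mean_return_infinite\<close> to \<open>u * i + v * j\<close>: weights of
  at most 1 bound its decrease per step by 1, and nonnegative drift makes it a
  submartingale.\<close>

lemma mean_return_K_infinite:
  fixes u v :: real
  assumes uv: "0 < u" "u \<le> 1" "0 < v" "v \<le> 1"
    and drift: "\<And>i j. u * (east i j - west i j) + v * (north i j - south i j) \<ge> 0"
  shows "mean_return K (0, 0) (0, 0) = \<infinity>"
proof -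
  define h :: "nat \<times> nat \<Rightarrow> real" where "h x = u * fst x + v * snd x" for x
  have h0: "0 \<le> h x" for x using uv by (simp add: h_def)
  have int: "(\<integral>\<^sup>+ y. ennreal (h y) \<partial>measure_pmf (K (i, j))) =
      ennreal (h (i, j) + (u * (east i j - west i j) + v * (north i j - south i j)))" for i j
    unfolding nn_integral_K_real[OF h0]
    by (cases i; cases j) (simp_all add: drift_def h_def west_def[of 0] south_def[of _ 0] algebra_simps)
  show ?thesis
  proof (rule mean_return_infinite[where h = "\<lambda>x. ennreal (h x)"])
    show "ennreal (h (0, 0)) = 0" by (simp add: h_def)
    show "ennreal (h x) \<le> (\<integral>\<^sup>+ y. ennreal (h y) \<partial>measure_pmf (K x))" for x
      using drift[of "fst x" "snd x"] by (cases x) (simp add: int ennreal_leI)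
    have "0 < u * east 0 0 + v * north 0 0"
      using uv rates_pos(1,2)[of 0 0] by (simp add: add_pos_pos)
    then show "0 < (\<integral>\<^sup>+ y. ennreal (h y) \<partial>measure_pmf (K (0, 0)))"
      unfolding int by (simp add: h_def west_def south_def)
    fix x y assume "y \<in> set_pmf (K x)"
    then have "y \<in> {(Suc (fst x), snd x), (fst x, Suc (snd x)), (fst x - 1, snd x), (fst x, snd x - 1), x}"
      using set_K[of "fst y" "snd y" "fst x" "snd x"] by simp
    then have "h x \<le> h y + 1"
      using uv by (cases x; cases "fst x"; cases "snd x") (auto simp: h_def algebra_simps)
    then show "ennreal (h x) \<le> ennreal (h y) + 1"
      using h0 by (metis ennreal_1 ennreal_leI ennreal_plus zero_le_one)
  qed simp
qed

text \<open>Foster's criterion: the drift is at most -1 off the finite set where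
  \<open>e * (i + j) < b + 1\<close>, and at most the absolute value of \<open>b\<close> on
  it.\<close>

lemma mean_return_K_finite:
  fixes V :: "nat \<times> nat \<Rightarrow> real"
  assumes V: "\<And>x. 0 \<le> V x" and e: "e > 0"
    and drift: "\<And>i j. drift V i j \<le> b - e * (real i + real j)"
  shows "mean_return K s x < \<infinity>"
proof (rule mean_return_finite[where V = "\<lambda>x. ennreal (V x)" and B = "ennreal (\<bar>b\<bar> + 1)"
      and F = "{x. e * (real (fst x) + real (snd x)) < b + 1}"])
  obtain m :: nat where m: "(b + 1) / e < m" using reals_Archimedean2 by blast
  have "{x. e * (real (fst x) + real (snd x)) < b + 1} \<subseteq> {..m} \<times> {..m}"
  proof
    fix x assume "x \<in> {x. e * (real (fst x) + real (snd x)) < b + 1}"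
    then have "real (fst x) + real (snd x) < (b + 1) / e" using e by (simp add: field_simps)
    then have "real (fst x) + real (snd x) < real m" using m by simp
    then show "x \<in> {..m} \<times> {..m}" by (cases x) auto
  qed
  then show "finite {x. e * (real (fst x) + real (snd x)) < b + 1}"
    by (rule finite_subset) simp
  have int: "(\<integral>\<^sup>+ y. ennreal (V y) \<partial>measure_pmf (K (i, j))) = ennreal (V (i, j) + drift V i j)"
    and nn: "0 \<le> V (i, j) + drift V i j" for i j
  proof -
    show "(\<integral>\<^sup>+ y. ennreal (V y) \<partial>measure_pmf (K (i, j))) = ennreal (V (i, j) + drift V i j)"
      by (rule nn_integral_K_real[OF V])
    have "V (i, j) + drift V i j = east i j * V (Suc i, j) + north i j * V (i, Suc j)
        + west i j * V (i - 1, j) + south i j * V (i, j - 1) + stay i j * V (i, j)"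
      by (simp add: drift_def stay_def algebra_simps)
    then show "0 \<le> V (i, j) + drift V i j" using V rates_nonneg by simp
  qed
  have add1: "ennreal r + 1 = ennreal (r + 1)" if "0 \<le> r" for r
    using that by (simp add: ennreal_plus)
  show "(\<integral>\<^sup>+ y. ennreal (V y) \<partial>measure_pmf (K x)) + 1 \<le> ennreal (V x)"
    if "x \<notin> {x. e * (real (fst x) + real (snd x)) < b + 1}" for x
  proof -
    obtain i j where x: "x = (i, j)" by (cases x)
    show ?thesis unfolding x int add1[OF nn]
      by (rule ennreal_leI) (use drift[of i j] that x in auto)
  qed
  show "(\<integral>\<^sup>+ y. ennreal (V y) \<partial>measure_pmf (K x)) + 1 \<le> ennreal (V x) + ennreal (\<bar>b\<bar> + 1)" for x
  proof -
    obtain i j where x: "x = (i, j)" by (cases x)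
    have "0 \<le> e * (real i + real j)" using e by simp
    then have "V (i, j) + drift V i j + 1 \<le> V (i, j) + (\<bar>b\<bar> + 1)" using drift[of i j] by linarith
    then show ?thesis unfolding x int add1[OF nn] using V[of "(i, j)"]
      by (simp add: ennreal_plus[symmetric] ennreal_leI del: ennreal_plus)
  qed
qed (auto intro: survival_K_less_1)

section \<open>Drifts of the linear test functions\<close>

definition R :: real where "R = lam * (lam + a1 + a2) - \<mu> * (a1 + a2)"

definition F1 :: real where "F1 = lam * (l1 + a1) - \<mu> * a1"

definition F2 :: real where "F2 = lam * (l2 + a2) - \<mu> * a2"

text \<open>Exchanging the orbits gives another instance of the model, so results for orbit 1 and
  \<open>j < i\<close> carry over to orbit 2 and \<open>i < j\<close>.\<close>

lemma swap: "jsq l0 l2 l1 \<mu> a2 a1"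
  using pos total by unfold_locales auto

lemma swap_rates:
  "jsq.east l0 l2 j i = north i j" "jsq.north l0 l1 j i = east i j"
  "jsq.west l0 l2 l1 \<mu> a2 a1 j i = south i j" "jsq.south l0 l2 l1 \<mu> a2 a1 j i = west i j"
proof -
  interpret sw: jsq l0 l2 l1 \<mu> a2 a1 by (rule swap)
  show "sw.east j i = north i j" "sw.north j i = east i j"
    "sw.west j i = south i j" "sw.south j i = west i j"
    by (auto simp: sw.east_def sw.north_def sw.west_def sw.south_def east_def north_def west_def south_def
        sw.lam_def lam_def add_ac)
qed

text \<open>The two arrival rates add up to \<open>lam\<close> on either side of the diagonal, so
  the drift of \<open>i + j\<close> is constant in the interior.\<close>

lemma sum_drift:
  assumes "0 < i" "0 < j"
  shows "east i j - west i j + (north i j - south i j) = R / (lam + a1 + a2)"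
proof -
  have D: "0 < lam + a1 + a2" using pos lam_pos by simp
  have "R / (lam + a1 + a2) = lam * (lam + a1 + a2) / (lam + a1 + a2)
      - (\<mu> * a1 / (lam + a1 + a2) + \<mu> * a2 / (lam + a1 + a2))"
    unfolding R_def diff_divide_distrib add_divide_distrib[symmetric] by (simp add: distrib_left)
  also have "lam * (lam + a1 + a2) / (lam + a1 + a2) = lam" using D by simp
  finally have "R / (lam + a1 + a2) = lam - (\<mu> * a1 / (lam + a1 + a2) + \<mu> * a2 / (lam + a1 + a2))" .
  moreover have "east i j + north i j = lam" by (simp add: east_def north_def lam_def)
  ultimately show ?thesis using assms by (simp add: west_def south_def)
qed

text \<open>
  The direction \<open>(lam + a1, a1)\<close> is the one in which the drifts of the region \<open>i > j > 0\<close> and of the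
  axis \<open>j = 0\<close> have the same component.
\<close>

lemma skew_drift:
  assumes "j < i"
  shows "(lam + a1) * (east i j - west i j) + a1 * (north i j - south i j) = F1"
proof (cases "j = 0")
  case True
  then show ?thesis
    using assms pos lam_pos
    by (simp add: east_def north_def west_def south_def F1_def lam_def field_simps)
next
  case False
  have D: "lam + a1 + a2 > 0" using pos lam_pos by simp
  have "(lam + a1) * (\<mu> * a1 / (lam + a1 + a2)) + a1 * (\<mu> * a2 / (lam + a1 + a2)) =
      \<mu> * a1 * (lam + a1 + a2) / (lam + a1 + a2)"
    unfolding times_divide_eq_right add_divide_distrib[symmetric] by (simp add: algebra_simps)
  also have "\<dots> = \<mu> * a1" using D by simp
  finally show ?thesis
    using assms False
    by (simp add: east_def north_def west_def south_def F1_def right_diff_distrib) (simp add: lam_def algebra_simps)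
qed

text \<open>In every region the drift is at least \<open>F1\<close>: for \<open>i \<le> j\<close>
  more arrivals join orbit 1, whose weight is larger by \<open>lam\<close>, and at
  \<open>i = 0\<close> the missing departures from orbit 1 outweigh the faster ones from orbit
  2.\<close>

lemma skew_drift_ge:
  assumes "0 \<le> F1"
  shows "0 \<le> (lam + a1) * (east i j - west i j) + a1 * (north i j - south i j)"
proof -
  consider "j < i" | "i \<le> j" "0 < i" | "i = 0" "0 < j" | "i = 0" "j = 0" by linarith
  then show ?thesis
  proof cases
    case 1
    then show ?thesis using skew_drift assms by simp
  next
    case 2
    \<comment> \<open>\<open>(Suc j, j)\<close> has the same service rates and lies where
      \<open>skew_drift\<close> applies; only arrivals are redirected.\<close>
    let ?i = "Suc j"
    have "west i j = west ?i j" "south i j = south ?i j" "l1 \<le> east i j"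
      using 2 pos by (auto simp: west_def south_def east_def)
    moreover have n: "north i j = lam - east i j" "north ?i j = lam - l1" "east ?i j = l1"
      by (auto simp: east_def north_def lam_def)
    ultimately have "F1 = (lam + a1) * (l1 - west i j) + a1 * (lam - l1 - south i j)"
      using skew_drift[of j ?i] by simp
    then have "(lam + a1) * (east i j - west i j) + a1 * (north i j - south i j) =
        F1 + lam * (east i j - l1)"
      by (simp add: n algebra_simps)
    moreover have "0 \<le> lam * (east i j - l1)"
      using lam_pos \<open>l1 \<le> east i j\<close> by simp
    ultimately show ?thesis using assms by simp
  next
    case 3
    have "a2 / (lam + a2) \<le> 1" using pos lam_pos by simp
    then have "(\<mu> * a1) * (a2 / (lam + a2)) \<le> (\<mu> * a1) * 1"
      using pos by (intro mult_left_mono) auto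
    moreover have "0 \<le> lam * l0" using pos lam_pos by simp
    moreover have "(lam + a1) * (east i j - west i j) + a1 * (north i j - south i j) =
        F1 + lam * l0 + \<mu> * a1 - (\<mu> * a1) * (a2 / (lam + a2))"
      using 3 by (simp add: east_def west_def north_def south_def F1_def right_diff_distrib)
        (simp add: lam_def algebra_simps)
    ultimately show ?thesis using assms by linarith
  next
    case 4
    then show ?thesis using pos lam_pos by (simp add: east_def west_def north_def south_def)
  qed
qed

lemma sum_drift_ge:
  assumes "0 \<le> R"
  shows "0 \<le> east i j - west i j + (north i j - south i j)"
proof -
  \<comment> \<open>On an axis only one orbit is served. If \<open>lam < \<mu>\<close>, the terms
    with \<open>b\<close> can be removed because \<open>lam * b \<le> \<mu> * b\<close>.\<close>
  have axis: "\<mu> * a / (lam + a) \<le> lam" if "0 < a" "0 < b" "\<mu> * (a + b) \<le> lam * (lam + a + b)" for a b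
  proof -
    have "\<mu> * a \<le> lam * (lam + a)"
    proof (cases "\<mu> \<le> lam")
      case True
      then have "\<mu> * a \<le> lam * a" "0 \<le> lam * lam" using that lam_pos by auto
      then show ?thesis unfolding distrib_left by linarith
    next
      case False
      then have "lam * b \<le> \<mu> * b" using that by simp
      then show ?thesis using that(3) by (simp add: algebra_simps)
    qed
    then show ?thesis using that lam_pos by (simp add: field_simps)
  qed
  have en: "east i j + north i j = lam" by (simp add: east_def north_def lam_def)
  consider "0 < i" "0 < j" | "i = 0" "j = 0" | "i = 0" "0 < j" | "0 < i" "j = 0" by linarith
  then show ?thesis
  proof cases
    case 1
    then show ?thesis using sum_drift[OF 1] assms pos lam_pos by simp
  next
    case 2
    then show ?thesis using en lam_pos by (simp add: west_def south_def)
  next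
    case 3
    then show ?thesis using en axis[of a2 a1] assms pos
      by (simp add: west_def south_def R_def algebra_simps)
  next
    case 4
    then show ?thesis using en axis[of a1 a2] assms pos
      by (simp add: west_def south_def R_def algebra_simps)
  qed
qed

section \<open>The quadratic Lyapunov function\<close>

definition kap1 :: real where "kap1 = lam / (lam + 2 * a1)"

definition kap2 :: real where "kap2 = lam / (lam + 2 * a2)"

text \<open>
  With \<open>c = a1 / (lam + a1)\<close> one has \<open>kap1 = (1 - c) / (1 + c)\<close>, so up to a factor \<open>V\<close> is
  \<open>i\<^sup>2 + 2 c i j + j\<^sup>2\<close> for \<open>i \<ge> j\<close>: its gradient is proportional to \<open>(1, c)\<close> on the axis
  \<open>j = 0\<close> and to \<open>(1, 1)\<close> on the diagonal, where the two pieces of \<open>V\<close> fit together differentiably.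
\<close>

definition V :: "nat \<times> nat \<Rightarrow> real" where
  "V = (\<lambda>(i, j). (real i + real j)\<^sup>2 + (if j \<le> i then kap1 else kap2) * (real i - real j)\<^sup>2)"

lemma kap: "0 \<le> kap1" "kap1 \<le> 1" "0 \<le> kap2" "kap2 \<le> 1"
  using pos lam_pos by (auto simp: kap1_def kap2_def)

lemma V_nonneg: "0 \<le> V x"
  using kap by (auto simp: V_def split: prod.split)

lemma rates_le_1: "east i j + north i j + west i j + south i j \<le> 1"
  using rates_nonneg(5)[of i j] by (simp add: stay_def)

text \<open>The gradient of \<open>V\<close> at \<open>(i, j)\<close> is \<open>j\<close> times the
  one at \<open>(1, 1)\<close> plus \<open>i - j\<close> times the one at \<open>(1, 0)\<close>.
  Paired with the drift vector, the first gives a multiple of \<open>R\<close> when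
  \<open>j > 0\<close> and the second a multiple of \<open>F1\<close>; the second-order term is at
  most 2.\<close>

lemma drift_V_gt:
  assumes ij: "j < i" and R: "R / (lam + a1 + a2) \<le> - e" and F: "2 * F1 / (lam + 2 * a1) \<le> - e"
  shows "drift V i j \<le> 2 - 2 * e * (real i + real j)"
proof -
  define x y where "x = east i j - west i j" and "y = north i j - south i j"
  define r where "r = east i j + north i j + west i j + south i j"
  obtain m where m: "i = Suc m" using ij by (cases i) auto
  \<comment> \<open>With \<open>j < i\<close> all neighbours lie in the \<open>kap1\<close> piece of
    \<open>V\<close>.\<close>
  have V: "V (Suc i, j) - V (i, j) = 2 * (real i + real j) + 1 + kap1 * (2 * (real i - real j) + 1)"
    "V (i, Suc j) - V (i, j) = 2 * (real i + real j) + 1 + kap1 * (1 - 2 * (real i - real j))"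
    "V (i - 1, j) - V (i, j) = 1 - 2 * (real i + real j) + kap1 * (1 - 2 * (real i - real j))"
    using ij by (simp_all add: V_def m power2_eq_square algebra_simps)
  have Vs: "south i j * (V (i, j - 1) - V (i, j)) =
      south i j * (1 - 2 * (real i + real j) + kap1 * (2 * (real i - real j) + 1))"
    using ij by (cases j) (simp_all add: V_def south_def power2_eq_square algebra_simps)
  have "drift V i j = 2 * ((real i + real j) * (x + y) + (real i - real j) * (kap1 * (x - y))) + (1 + kap1) * r"
    unfolding drift_def Vs unfolding V x_def y_def r_def by (simp add: algebra_simps)
  also have "(real i + real j) * (x + y) + (real i - real j) * (kap1 * (x - y)) =
      2 * real j * (x + y) + (real i - real j) * (x + y + kap1 * (x - y))"
    by (simp add: algebra_simps)
  also have "x + y + kap1 * (x - y) = 2 * F1 / (lam + 2 * a1)"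
    using skew_drift[OF ij] pos lam_pos unfolding x_def y_def kap1_def by (simp add: field_simps)
  also have "2 * (2 * real j * (x + y) + (real i - real j) * (2 * F1 / (lam + 2 * a1))) + (1 + kap1) * r
      \<le> 2 * (2 * real j * (- e) + (real i - real j) * (- e)) + 2"
  proof (intro add_mono mult_left_mono[of _ _ 2])
    show "2 * real j * (x + y) \<le> 2 * real j * (- e)"
    proof (cases "j = 0")
      case False
      then have "x + y \<le> - e" using sum_drift[of i j] ij R by (simp add: x_def y_def)
      then show ?thesis by (rule mult_left_mono) simp
    qed simp
    show "(real i - real j) * (2 * F1 / (lam + 2 * a1)) \<le> (real i - real j) * (- e)"
      using ij F by (intro mult_left_mono) auto
    have "(1 + kap1) * r \<le> 2 * 1"
      using kap rates_le_1[of i j] rates_nonneg[of i j] unfolding r_def by (intro mult_mono) auto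
    then show "(1 + kap1) * r \<le> 2" by simp
  qed simp
  finally show ?thesis by (simp add: algebra_simps)
qed

text \<open>The neighbours lie in different pieces of \<open>V\<close>, but \<open>i - j\<close>
  vanishes on the diagonal, so \<open>kap1\<close> and \<open>kap2\<close> enter only the bounded
  term.\<close>

lemma drift_V_eq:
  assumes R: "R / (lam + a1 + a2) \<le> - e"
  shows "drift V i i \<le> 2 - 2 * e * (real i + real i)"
proof -
  define r where "r = east i i + north i i + west i i + south i i"
  have V: "V (Suc i, i) - V (i, i) = 4 * real i + 1 + kap1"
    "V (i, Suc i) - V (i, i) = 4 * real i + 1 + kap2"
    by (simp_all add: V_def power2_eq_square algebra_simps)
  have Vw: "west i i * (V (i - 1, i) - V (i, i)) = west i i * (1 - 4 * real i + kap2)"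
    by (cases i) (simp_all add: V_def west_def power2_eq_square algebra_simps)
  have Vs: "south i i * (V (i, i - 1) - V (i, i)) = south i i * (1 - 4 * real i + kap1)"
    by (cases i) (simp_all add: V_def south_def power2_eq_square algebra_simps)
  have "drift V i i = 4 * (real i * (east i i - west i i + (north i i - south i i)))
      + (east i i * (1 + kap1) + north i i * (1 + kap2) + west i i * (1 + kap2) + south i i * (1 + kap1))"
    unfolding drift_def Vs Vw V by (simp add: algebra_simps)
  also have "\<dots> \<le> 4 * (real i * (- e)) + (east i i * 2 + north i i * 2 + west i i * 2 + south i i * 2)"
  proof (rule add_mono)
    have "real i * (east i i - west i i + (north i i - south i i)) \<le> real i * (- e)"
    proof (cases "i = 0")
      case False
      then show ?thesis using sum_drift[of i i] R by (intro mult_left_mono) auto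
    qed simp
    then show "4 * (real i * (east i i - west i i + (north i i - south i i))) \<le> 4 * (real i * (- e))"
      by (rule mult_left_mono) simp
    show "east i i * (1 + kap1) + north i i * (1 + kap2) + west i i * (1 + kap2) + south i i * (1 + kap1)
        \<le> east i i * 2 + north i i * 2 + west i i * 2 + south i i * 2"
      using kap rates_nonneg by (intro add_mono mult_left_mono) auto
  qed
  also have "\<dots> \<le> 4 * (real i * (- e)) + 2"
    using rates_le_1[of i i] by simp
  finally show ?thesis by (simp add: algebra_simps)
qed

lemma drift_V_lt:
  assumes ij: "i < j" and R: "R / (lam + a1 + a2) \<le> - e" and F: "2 * F2 / (lam + 2 * a2) \<le> - e"
  shows "drift V i j \<le> 2 - 2 * e * (real i + real j)"
proof -
  interpret sw: jsq l0 l2 l1 \<mu> a2 a1 by (rule swap)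
  have lam: "sw.lam = lam" by (simp add: sw.lam_def lam_def)
  \<comment> \<open>The two functions use different pieces for \<open>k = l\<close>, where the
    squared difference is 0.\<close>
  have V: "sw.V (l, k) = V (k, l)" for k l
    by (auto simp: sw.V_def V_def sw.kap1_def sw.kap2_def kap1_def kap2_def lam power2_commute add_ac)
  have "sw.drift sw.V j i = drift V i j"
    by (simp add: sw.drift_def drift_def swap_rates V)
  moreover have "sw.drift sw.V j i \<le> 2 - 2 * e * (real j + real i)"
    by (rule sw.drift_V_gt) (use ij R F in \<open>simp_all add: lam sw.R_def R_def sw.F1_def F2_def add_ac\<close>)
  ultimately show ?thesis by (simp add: add.commute)
qed

section \<open>The stability criterion and the shape of the stability region\<close>

lemma mean_return_K_finite_iff:
  "(\<forall>s. mean_return K s s < \<infinity>) \<longleftrightarrow> R < 0 \<and> F1 < 0 \<and> F2 < 0"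
proof
  assume fin: "\<forall>s. mean_return K s s < \<infinity>"
  \<comment> \<open>As the rates add up to 1, the weights of the two skew functions are at most
    1.\<close>
  have le1: "lam + a1 \<le> 1" "lam + a2 \<le> 1" "0 < lam" "a1 \<le> 1" "a2 \<le> 1"
    using pos total by (auto simp: lam_def)
  have "R < 0"
    using mean_return_K_infinite[of 1 1] sum_drift_ge fin by (metis less_irrefl linorder_not_less mult_1 order_refl zero_less_one)
  moreover have "F1 < 0"
  proof (rule ccontr)
    assume "\<not> F1 < 0"
    then have "mean_return K (0, 0) (0, 0) = \<infinity>"
      using le1 pos by (intro mean_return_K_infinite[of "lam + a1" a1] skew_drift_ge) auto
    then show False using fin by (metis less_irrefl)
  qed
  moreover have "F2 < 0"
  proof (rule ccontr)
    assume F2: "\<not> F2 < 0"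
    interpret sw: jsq l0 l2 l1 \<mu> a2 a1 by (rule swap)
    have lam: "sw.lam = lam" by (simp add: sw.lam_def lam_def)
    have "0 \<le> (lam + a2) * (north i j - south i j) + a2 * (east i j - west i j)" for i j
    proof -
      show ?thesis using sw.skew_drift_ge[of j i] F2
        by (simp add: lam swap_rates sw.F1_def F2_def)
    qed
    then have "mean_return K (0, 0) (0, 0) = \<infinity>"
      using le1 pos by (intro mean_return_K_infinite[of a2 "lam + a2"]) (auto simp: add.commute)
    then show False using fin by (metis less_irrefl)
  qed
  ultimately show "R < 0 \<and> F1 < 0 \<and> F2 < 0" by blast
next
  assume neg: "R < 0 \<and> F1 < 0 \<and> F2 < 0"
  \<comment> \<open>The smallest absolute value of the three normalised negative drifts, so that
    \<open>- e\<close> bounds all of them.\<close>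
  define e where "e = - Max {R / (lam + a1 + a2), 2 * F1 / (lam + 2 * a1), 2 * F2 / (lam + 2 * a2)}"
  have "0 < e"
    using neg pos lam_pos by (simp add: e_def divide_neg_pos)
  have le: "R / (lam + a1 + a2) \<le> - e" "2 * F1 / (lam + 2 * a1) \<le> - e" "2 * F2 / (lam + 2 * a2) \<le> - e"
    by (simp_all add: e_def)
  have "drift V i j \<le> 2 - 2 * e * (real i + real j)" for i j
    using drift_V_gt[OF _ le(1,2)] drift_V_eq[OF le(1)] drift_V_lt[OF _ le(1,3)]
    by (cases i j rule: linorder_cases) auto
  then show "\<forall>s. mean_return K s s < \<infinity>"
    using mean_return_K_finite[of V "2 * e" 2] V_nonneg \<open>0 < e\<close> by simp
qed

text \<open>The identities \<open>D * Fk = lam * Ak + ak * R\<close> and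
  \<open>R = l0 * D + A1 + A2\<close> with \<open>Ak = lk * D - \<mu> * ak\<close> reduce the claim
  to signs: \<open>Ak \<ge> 0\<close> and \<open>Fk < 0\<close> force \<open>R < 0\<close>, then the
  other \<open>A\<close> is negative, and with it the other \<open>F\<close>.\<close>

lemma stability_regions:
  "R < 0 \<and> F1 < 0 \<and> F2 < 0 \<longleftrightarrow>
    (l1 * (lam + a1 + a2) < \<mu> * a1 \<and> l2 * (lam + a1 + a2) < \<mu> * a2 \<and> R < 0) \<or>
    (\<mu> * a1 \<le> l1 * (lam + a1 + a2) \<and> F1 < 0) \<or> (\<mu> * a2 \<le> l2 * (lam + a1 + a2) \<and> F2 < 0)"
proof -
  define D where "D = lam + a1 + a2"
  define A1 A2 where "A1 = l1 * D - \<mu> * a1" and "A2 = l2 * D - \<mu> * a2"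
  have D: "0 < D" using pos lam_pos by (simp add: D_def)
  have F: "D * F1 = lam * A1 + a1 * R" "D * F2 = lam * A2 + a2 * R"
    by (simp_all add: F1_def F2_def R_def A1_def A2_def D_def algebra_simps)
  have R: "R = l0 * D + A1 + A2"
    by (simp add: R_def A1_def A2_def D_def lam_def algebra_simps)
  have "0 < l0 * D" using pos D by simp
  have iff: "F1 < 0 \<longleftrightarrow> lam * A1 + a1 * R < 0" "F2 < 0 \<longleftrightarrow> lam * A2 + a2 * R < 0"
    unfolding F[symmetric] using D by (simp_all add: mult_less_0_iff)
  have neg: "A < 0 \<Longrightarrow> R < 0 \<Longrightarrow> 0 < a \<Longrightarrow> lam * A + a * R < 0" for A a
    using lam_pos by (intro add_neg_neg) (simp_all add: mult_pos_neg)
  have imp: "R < 0" if "0 \<le> A" "0 < a" "lam * A + a * R < 0" for A a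
  proof -
    have "0 \<le> lam * A" using that lam_pos by simp
    then have "a * R < 0" using that by linarith
    then show ?thesis using that by (simp add: mult_less_0_iff)
  qed
  have "R < 0 \<and> F1 < 0 \<and> F2 < 0 \<longleftrightarrow> (A1 < 0 \<and> A2 < 0 \<and> R < 0) \<or> (0 \<le> A1 \<and> F1 < 0) \<or> (0 \<le> A2 \<and> F2 < 0)"
    using neg[of A1 a1] neg[of A2 a2] imp[of A1 a1] imp[of A2 a2] R \<open>0 < l0 * D\<close> pos unfolding iff by argo
  then show ?thesis by (simp add: A1_def A2_def D_def)
qed

end

theorem lemma1:
  fixes lam\<^sub>0 lam\<^sub>1 lam\<^sub>2 \<mu> \<alpha>\<^sub>1 \<alpha>\<^sub>2 lam lamh lamh\<^sub>1 lamh\<^sub>2 \<mu>h\<^sub>1 \<mu>h\<^sub>2 \<rho>\<^sub>1 \<rho>\<^sub>2 \<rho> f\<^sub>1 f\<^sub>2 :: real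
    and P :: "nat \<times> nat \<Rightarrow> 'w measure"
    and X :: "nat \<Rightarrow> 'w \<Rightarrow> nat \<times> nat"
  assumes "lam\<^sub>0 > 0" and "lam\<^sub>1 > 0" and "lam\<^sub>2 > 0" and "\<mu> > 0" and "\<alpha>\<^sub>1 > 0" and "\<alpha>\<^sub>2 > 0"
    and "lam = lam\<^sub>0 + lam\<^sub>1 + lam\<^sub>2"
    and "lam + \<mu> + \<alpha>\<^sub>1 + \<alpha>\<^sub>2 = 1"
    and "lamh = lam * (lam + \<alpha>\<^sub>1 + \<alpha>\<^sub>2)"
    and "lamh\<^sub>1 = lam\<^sub>1 * (lam + \<alpha>\<^sub>1 + \<alpha>\<^sub>2)" and "lamh\<^sub>2 = lam\<^sub>2 * (lam + \<alpha>\<^sub>1 + \<alpha>\<^sub>2)"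
    and "\<mu>h\<^sub>1 = \<mu> * \<alpha>\<^sub>1" and "\<mu>h\<^sub>2 = \<mu> * \<alpha>\<^sub>2"
    and "\<rho>\<^sub>1 = lamh\<^sub>1 / \<mu>h\<^sub>1" and "\<rho>\<^sub>2 = lamh\<^sub>2 / \<mu>h\<^sub>2"
    and "\<rho> = lamh / (\<mu>h\<^sub>1 + \<mu>h\<^sub>2)"
    and "f\<^sub>1 = lam * (lam\<^sub>1 + \<alpha>\<^sub>1) / \<mu>h\<^sub>1 - 1" and "f\<^sub>2 = lam * (lam\<^sub>2 + \<alpha>\<^sub>2) / \<mu>h\<^sub>2 - 1"
    and "\<And>x. markov_chain_from (P x) (jsq_trans lam\<^sub>0 lam\<^sub>1 lam\<^sub>2 \<mu> \<alpha>\<^sub>1 \<alpha>\<^sub>2) x X"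
  shows "positive_recurrent P X \<longleftrightarrow>
           (\<rho>\<^sub>1 < 1 \<and> \<rho>\<^sub>2 < 1 \<and> \<rho> < 1) \<or>
           (\<rho>\<^sub>1 \<ge> 1 \<and> f\<^sub>1 < 0) \<or>
           (\<rho>\<^sub>2 \<ge> 1 \<and> f\<^sub>2 < 0)"
proof -
  interpret Q: jsq lam\<^sub>0 lam\<^sub>1 lam\<^sub>2 \<mu> \<alpha>\<^sub>1 \<alpha>\<^sub>2
    by unfold_locales (use assms(1-8) in simp_all)
  have lam: "Q.lam = lam" using assms(7) by (simp add: Q.lam_def)
  have "markov_chain_from (P x) (\<lambda>x y. pmf (Q.K x) y) x X" for x
    unfolding Q.pmf_K by (rule assms(19))
  \<comment> \<open>\<open>P s\<close> starts the chain in \<open>s\<close>, so the case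
    \<open>x = s\<close> of the formula is the mean return time in question.\<close>
  from nn_integral_return_time[OF this]
  have "positive_recurrent P X \<longleftrightarrow> (\<forall>s. mean_return Q.K s s < \<infinity>)"
    unfolding positive_recurrent_def by simp
  also have "\<dots> \<longleftrightarrow> (\<rho>\<^sub>1 < 1 \<and> \<rho>\<^sub>2 < 1 \<and> \<rho> < 1) \<or> (\<rho>\<^sub>1 \<ge> 1 \<and> f\<^sub>1 < 0) \<or> (\<rho>\<^sub>2 \<ge> 1 \<and> f\<^sub>2 < 0)"
  proof -
    have p: "0 < \<mu>h\<^sub>1" "0 < \<mu>h\<^sub>2" "0 < \<mu>h\<^sub>1 + \<mu>h\<^sub>2" using assms(1-6,12,13) by (simp_all add: add_pos_pos)
    have "\<rho> < 1 \<longleftrightarrow> Q.R < 0" "f\<^sub>1 < 0 \<longleftrightarrow> Q.F1 < 0" "f\<^sub>2 < 0 \<longleftrightarrow> Q.F2 < 0"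
      unfolding assms(16-18) Q.R_def Q.F1_def Q.F2_def lam using p
      by (simp_all add: divide_less_eq assms(9,12,13) distrib_left)
    moreover have "\<rho>\<^sub>1 < 1 \<longleftrightarrow> lam\<^sub>1 * (lam + \<alpha>\<^sub>1 + \<alpha>\<^sub>2) < \<mu> * \<alpha>\<^sub>1"
      "\<rho>\<^sub>2 < 1 \<longleftrightarrow> lam\<^sub>2 * (lam + \<alpha>\<^sub>1 + \<alpha>\<^sub>2) < \<mu> * \<alpha>\<^sub>2"
      "1 \<le> \<rho>\<^sub>1 \<longleftrightarrow> \<mu> * \<alpha>\<^sub>1 \<le> lam\<^sub>1 * (lam + \<alpha>\<^sub>1 + \<alpha>\<^sub>2)"
      "1 \<le> \<rho>\<^sub>2 \<longleftrightarrow> \<mu> * \<alpha>\<^sub>2 \<le> lam\<^sub>2 * (lam + \<alpha>\<^sub>1 + \<alpha>\<^sub>2)"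
      unfolding assms(14,15) using p by (simp_all add: divide_less_eq le_divide_eq assms(10-13))
    ultimately show ?thesis
      unfolding Q.mean_return_K_finite_iff Q.stability_regions lam by simp
  qed
  finally show ?thesis .
qed

end
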